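(* Let $H$ be a finite simple graph with $|V(H)|=n$, let $m=\operatorname{girth}(H)$, let $G=W(H)$ be the whisker graph of $H$, and let $\mathbb{K}$ be a field. (Sequentially) Cohen-Macaulay means over $\mathbb{K}$. Let $1\le q\le\nu(G)$. (1) Suppose $H$ is bipartite. If $m<\infty$, then $\mathsf{MF}^q(G)$ is Cohen-Macaulay if $1\le q\le\lfloor m/2\rfloor$, and is pure if $\lfloor m/2\rfloor<q\le\nu(G)$. If $m=\infty$, then $\mathsf{MF}^q(G)$ is Cohen-Macaulay for all $1\le q\le\nu(G)$. (2) Suppose $H$ is non-bipartite, and let $\ell$ be the length of the smallest odd cycle of $H$. (2a) If $m$ is even, then $\mathsf{MF}^q(G)$ is: Cohen-Macaulay if $1\le q\le m/2$; pure if $m/2<q<\lceil\ell/2\rceil$; not pure if $\lceil\ell/2\rceil\le q\le n-\lfloor\ell/2\rfloor$; pure if $n-\lfloor\ell/2\rfloor<q\le\nu(G)$. (2b) If $m$ is odd (hence $m=\ell$), then $\mathsf{MF}^q(G)$ is: Cohen-Macaulay if $1\le q<\lceil m/2\rceil$; sequentially Cohen-Macaulay but not pure if $q=\lceil m/2\rceil$; not pure if $\lceil m/2\rceil<q\le n-\lfloor m/2\rfloor$; pure if $n-\lfloor m/2\rfloor<q\le\nu(G)$.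
   Context: For a finite simple graph $H$ with vertices $x_1,\dots,x_n$, the whisker graph $W(H)$ has vertex set $\{x_1,\dots,x_n,y_1,\dots,y_n\}$ (the $y_i$ being new vertices) and edge set $E(H)\cup\{\{x_i,y_i\}: 1\le i\le n\}$. The girth of $H$ is the length of its shortest cycle, with $\operatorname{girth}(H)=\infty$ if $H$ is acyclic. The matching number $\nu(G)$ is the maximum size of a set of pairwise disjoint edges of $G$. For $q\ge1$, $\mathsf{MF}^q(G)$ is the simplicial complex on $V(G)$ whose faces are the subsets $F\subseteq V(G)$ such that the induced subgraph $G[F]$ contains no matching of size $q$. A simplicial complex is pure if all its facets have the same dimension. $\Delta$ is Cohen-Macaulay over $\mathbb{K}$ if $\widetilde H_i(\operatorname{link}_\Delta(\sigma);\mathbb{K})=0$ for all $\sigma\in\Delta$ and all $i<\dim\operatorname{link}_\Delta(\sigma)$. $\Delta$ is sequentially Cohen-Macaulay over $\mathbb{K}$ if for every $d$ its pure $d$-skeleton (the subcomplex generated by all faces of dimension exactly $d$) is Cohen-Macaulay over $\mathbb{K}$. *)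

theory Defs
  imports
    "HOL-Library.Poly_Mapping"
    "HOL-Library.Extended_Nat"
    "HOL-Library.Disjoint_Sets"
begin

section \<open>Graphs\<close>

record 'a ugraph =
  verts :: "'a set"
  edges :: "'a set set"

definition finite_simple_graph :: "'a ugraph \<Rightarrow> bool" where
  "finite_simple_graph G \<longleftrightarrow>
     finite (verts G) \<and> (\<forall>e\<in>edges G. e \<subseteq> verts G \<and> card e = 2)"

(* Inl x is the vertex x of H, and Inr x is the whisker vertex attached to x. *)
definition whisker_graph :: "'a ugraph \<Rightarrow> ('a + 'a) ugraph" where
  "whisker_graph H =
     \<lparr>verts = verts H <+> verts H,
      edges = (\<lambda>e. Inl ` e) ` edges H \<union> {{Inl x, Inr x} | x. x \<in> verts H}\<rparr>"

definition induced_subgraph :: "'a ugraph \<Rightarrow> 'a set \<Rightarrow> 'a ugraph" where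
  "induced_subgraph G F = \<lparr>verts = F, edges = {e \<in> edges G. e \<subseteq> F}\<rparr>"

definition bipartite :: "'a ugraph \<Rightarrow> bool" where
  "bipartite G \<longleftrightarrow>
     (\<exists>A B. A \<union> B = verts G \<and> A \<inter> B = {} \<and> (\<forall>e\<in>edges G. \<exists>a\<in>A. \<exists>b\<in>B. e = {a, b}))"

(* A cycle is given by the list of its vertices in cyclic order, without repetition. *)
definition cycle :: "'a ugraph \<Rightarrow> 'a list \<Rightarrow> bool" where
  "cycle G p \<longleftrightarrow>
     3 \<le> length p \<and> distinct p \<and>
     (\<forall>i<length p. {p ! i, p ! (Suc i mod length p)} \<in> edges G)"

(* The infimum of the empty set in enat is infinity. *)
definition girth :: "'a ugraph \<Rightarrow> enat" where
  "girth G = Inf {enat (length p) | p. cycle G p}"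

definition odd_girth :: "'a ugraph \<Rightarrow> enat" where
  "odd_girth G = Inf {enat (length p) | p. cycle G p \<and> odd (length p)}"

definition matching :: "'a ugraph \<Rightarrow> 'a set set \<Rightarrow> bool" where
  "matching G M \<longleftrightarrow> M \<subseteq> edges G \<and> disjoint M"

definition matching_number :: "'a ugraph \<Rightarrow> nat" where
  "matching_number G = Max {card M | M. matching G M}"


section \<open>Simplicial complexes\<close>

text \<open>A (finite) simplicial complex is represented by its set of faces, which includes the
  empty face unless the complex is void.\<close>

definition face_dim :: "'a set \<Rightarrow> int" where
  "face_dim \<sigma> = int (card \<sigma>) - 1"

definition complex_dim :: "'a set set \<Rightarrow> int" where
  "complex_dim \<Delta> = Max (face_dim ` \<Delta>)"

definition facet :: "'a set set \<Rightarrow> 'a set \<Rightarrow> bool" where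
  "facet \<Delta> \<sigma> \<longleftrightarrow> \<sigma> \<in> \<Delta> \<and> (\<forall>\<tau>\<in>\<Delta>. \<sigma> \<subseteq> \<tau> \<longrightarrow> \<tau> = \<sigma>)"

definition pure :: "'a set set \<Rightarrow> bool" where
  "pure \<Delta> \<longleftrightarrow> (\<forall>\<sigma> \<tau>. facet \<Delta> \<sigma> \<and> facet \<Delta> \<tau> \<longrightarrow> face_dim \<sigma> = face_dim \<tau>)"

definition link :: "'a set set \<Rightarrow> 'a set \<Rightarrow> 'a set set" where
  "link \<Delta> \<sigma> = {\<tau> \<in> \<Delta>. \<tau> \<inter> \<sigma> = {} \<and> \<tau> \<union> \<sigma> \<in> \<Delta>}"

definition pure_skeleton :: "'a set set \<Rightarrow> int \<Rightarrow> 'a set set" where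
  "pure_skeleton \<Delta> d = {\<tau>. \<exists>\<sigma>\<in>\<Delta>. face_dim \<sigma> = d \<and> \<tau> \<subseteq> \<sigma>}"

definition MF :: "nat \<Rightarrow> 'a ugraph \<Rightarrow> 'a set set" where
  "MF q G = {F. F \<subseteq> verts G \<and> \<not> (\<exists>M. matching (induced_subgraph G F) M \<and> card M = q)}"


section \<open>Reduced simplicial homology\<close>

text \<open>Faces are oriented by one fixed total order on the vertex type.\<close>

definition vertex_order :: "'a rel" where
  "vertex_order = (SOME r. linear_order r)"

lemma linear_order_vertex_order: "linear_order (vertex_order :: 'a rel)"
proof -
  obtain r :: "'a rel" where "well_order r"
    using well_order_on by blast
  then have "linear_order r"
    by (simp add: well_order_on_def)
  then show ?thesis
    unfolding vertex_order_def by (rule someI)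
qed

text \<open>The sign \<open>(-1)\<^sup>j\<close>, where \<open>v\<close> is the \<open>j\<close>-th vertex of \<open>\<sigma>\<close>, counting from \<open>0\<close>.\<close>

definition incidence_sign :: "'a set \<Rightarrow> 'a \<Rightarrow> 'k::field" where
  "incidence_sign \<sigma> v = (- 1) ^ card {w \<in> \<sigma>. w \<noteq> v \<and> (w, v) \<in> vertex_order}"

definition chains :: "'a set set \<Rightarrow> int \<Rightarrow> ('a set \<Rightarrow>\<^sub>0 'k::field) set" where
  "chains \<Delta> i = {c. Poly_Mapping.keys c \<subseteq> {\<sigma> \<in> \<Delta>. face_dim \<sigma> = i}}"

(* On 0-chains this is the augmentation, since the empty face spans the chains in degree -1. *)
definition boundary :: "('a set \<Rightarrow>\<^sub>0 'k::field) \<Rightarrow> ('a set \<Rightarrow>\<^sub>0 'k)" where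
  "boundary c =
     (\<Sum>\<sigma>\<in>Poly_Mapping.keys c. \<Sum>v\<in>\<sigma>.
        Poly_Mapping.single (\<sigma> - {v}) (incidence_sign \<sigma> v * Poly_Mapping.lookup c \<sigma>))"

definition reduced_cycles :: "'a set set \<Rightarrow> int \<Rightarrow> ('a set \<Rightarrow>\<^sub>0 'k::field) set" where
  "reduced_cycles \<Delta> i = {c \<in> chains \<Delta> i. boundary c = 0}"

definition reduced_boundaries :: "'a set set \<Rightarrow> int \<Rightarrow> ('a set \<Rightarrow>\<^sub>0 'k::field) set" where
  "reduced_boundaries \<Delta> i = boundary ` chains \<Delta> (i + 1)"

text \<open>The underlying set of the quotient space of cycles modulo boundaries; its zero element is
  the coset \<open>reduced_boundaries \<Delta> i\<close>.\<close>

definition reduced_homology :: "'a set set \<Rightarrow> int \<Rightarrow> ('a set \<Rightarrow>\<^sub>0 'k::field) set set" where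
  "reduced_homology \<Delta> i = (\<lambda>z. (\<lambda>b. z + b) ` reduced_boundaries \<Delta> i) ` reduced_cycles \<Delta> i"

text \<open>The field of coefficients is passed as the type argument \<open>TYPE('k)\<close>.\<close>

definition homology_vanishes :: "'k::field itself \<Rightarrow> 'a set set \<Rightarrow> int \<Rightarrow> bool" where
  "homology_vanishes K \<Delta> i \<longleftrightarrow>
     (reduced_homology \<Delta> i :: ('a set \<Rightarrow>\<^sub>0 'k) set set) = {reduced_boundaries \<Delta> i}"

definition cohen_macaulay :: "'k::field itself \<Rightarrow> 'a set set \<Rightarrow> bool" where
  "cohen_macaulay K \<Delta> \<longleftrightarrow>
     (\<forall>\<sigma>\<in>\<Delta>. \<forall>i<complex_dim (link \<Delta> \<sigma>). homology_vanishes K (link \<Delta> \<sigma>) i)"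

definition sequentially_cohen_macaulay :: "'k::field itself \<Rightarrow> 'a set set \<Rightarrow> bool" where
  "sequentially_cohen_macaulay K \<Delta> \<longleftrightarrow> (\<forall>d. cohen_macaulay K (pure_skeleton \<Delta> d))"

end

theory Submission
  imports Defs
begin

text \<open>
  A face of the complex is given by the set \<open>X\<close> of its vertices in \<open>H\<close> and the set \<open>Y\<close> of the
  vertices of \<open>H\<close> whose pendant vertices it contains. A maximum matching of the face can be chosen
  to use all whiskers inside it, so its size is \<open>card (X \<inter> Y) + nu H (X - Y)\<close>
  (\<open>nu_whisker\<close>). The theorem follows from an analysis of this weight. Let \<open>n\<close> be the number of
  vertices of \<open>H\<close>.

  Purity. A facet satisfies \<open>X \<union> Y = verts H\<close> and has weight \<open>q - 1\<close>, and every vertex of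
  \<open>B = X - Y\<close> is missed by some maximum matching of \<open>B\<close> (\<open>facet_whisker\<close>). It has
  \<open>n + q - 1 - nu H B\<close> elements. In a bipartite graph with an edge some vertex lies in all maximum
  matchings (\<open>bipartite_essential_vertex\<close>, the core of Koenig's theorem). Hence \<open>nu H B = 0\<close>
  unless \<open>B\<close> contains an odd cycle, and if it contains one of length \<open>2 * k + 1\<close>, then counting
  gives \<open>k < q\<close> and \<open>q \<le> n - k\<close>. Conversely, under these two inequalities the cycle can be
  completed to a facet that is too small.

  Cohen--Macaulayness. Reduced homology vanishes in the required range for a complex if it does so
  for the deletion of a vertex and, one degree lower, for its link; the property
  \<open>cm_upto K \<Delta> d\<close> records this for all links of \<open>\<Delta>\<close> at once
  (\<open>cm_upto_deletion_link\<close>). Deciding in this way which vertices of \<open>H\<close> belong to the face,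
  one is left with a fixed \<open>X\<close> and the complex of the sets \<open>Y\<close> of small weight. If \<open>X\<close>
  induces a forest, then this complex is treated by induction on leaves
  (\<open>cm_upto_pendant_forest\<close>). So the subcomplex of the faces for which \<open>X\<close> induces a forest is
  Cohen--Macaulay of dimension \<open>n + q - 2\<close>, as long as sets with fewer than \<open>q\<close> vertices
  contain no cycle. For \<open>q\<close> up to half the girth every face is of this kind, since a cycle
  contains a matching of half its length.

  If the girth \<open>m\<close> is odd and \<open>q = (m + 1) div 2\<close>, then a face containing a cycle contains
  no whisker, so it has at most \<open>n\<close> elements. The pure skeleta of dimension at least \<open>n\<close> are
  therefore skeleta of the Cohen--Macaulay subcomplex above. The lower ones are skeleta of the
  whole complex, which satisfies \<open>cm_upto\<close> with \<open>d = n - 1\<close> for every \<open>q\<close>, because all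
  pendant vertices of \<open>H\<close> can be used.
\<close>

section \<open>Chains, cones and vanishing homology\<close>

definition simplicial_complex :: "'a set set \<Rightarrow> bool" where
  "simplicial_complex \<Delta> \<longleftrightarrow> (\<forall>\<sigma>\<in>\<Delta>. finite \<sigma> \<and> (\<forall>\<tau>. \<tau> \<subseteq> \<sigma> \<longrightarrow> \<tau> \<in> \<Delta>))"

lemma complexD: "simplicial_complex \<Delta> \<Longrightarrow> \<sigma> \<in> \<Delta> \<Longrightarrow> finite \<sigma>"
  "simplicial_complex \<Delta> \<Longrightarrow> \<sigma> \<in> \<Delta> \<Longrightarrow> \<tau> \<subseteq> \<sigma> \<Longrightarrow> \<tau> \<in> \<Delta>"
  by (auto simp: simplicial_complex_def)

definition deletion :: "'a set set \<Rightarrow> 'a \<Rightarrow> 'a set set" where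
  "deletion \<Delta> v = {\<sigma> \<in> \<Delta>. v \<notin> \<sigma>}"

lemma complex_deletion: "simplicial_complex \<Delta> \<Longrightarrow> simplicial_complex (deletion \<Delta> v)"
  by (auto simp: simplicial_complex_def deletion_def)

lemma complex_link:
  assumes "simplicial_complex \<Delta>"
  shows "simplicial_complex (link \<Delta> \<sigma>)"
  unfolding simplicial_complex_def
proof (intro ballI conjI allI impI)
  fix \<rho> assume \<rho>: "\<rho> \<in> link \<Delta> \<sigma>"
  then show "finite \<rho>"
    using assms by (auto simp: link_def simplicial_complex_def)
  fix \<tau> assume "\<tau> \<subseteq> \<rho>"
  then have "\<tau> \<union> \<sigma> \<subseteq> \<rho> \<union> \<sigma>" "\<tau> \<subseteq> \<rho>"
    by auto
  then show "\<tau> \<in> link \<Delta> \<sigma>"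
    using \<rho> complexD(2)[OF assms] unfolding link_def by blast
qed

text \<open>The boundary operator and the cone operator below both extend a map on oriented faces, so
  additivity is proved once for all such extensions.\<close>

definition linear_extension ::
    "('b \<Rightarrow> 'k \<Rightarrow> ('b \<Rightarrow>\<^sub>0 'k)) \<Rightarrow> ('b \<Rightarrow>\<^sub>0 'k) \<Rightarrow> ('b \<Rightarrow>\<^sub>0 'k::field)" where
  "linear_extension f c = (\<Sum>\<sigma>\<in>Poly_Mapping.keys c. f \<sigma> (Poly_Mapping.lookup c \<sigma>))"

lemma linear_extension_single:
  assumes "\<And>\<sigma>. f \<sigma> 0 = 0"
  shows "linear_extension f (Poly_Mapping.single \<sigma> a) = f \<sigma> a"
  using assms by (cases "a = 0") (auto simp: linear_extension_def)

lemma linear_extension_superset: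
  assumes "\<And>\<sigma>. f \<sigma> 0 = 0" and "finite S" and "Poly_Mapping.keys c \<subseteq> S"
  shows "linear_extension f c = (\<Sum>\<sigma>\<in>S. f \<sigma> (Poly_Mapping.lookup c \<sigma>))"
  unfolding linear_extension_def
  using assms by (intro sum.mono_neutral_left) (auto simp: in_keys_iff)

lemma linear_extension_add:
  assumes "\<And>\<sigma> a b. f \<sigma> (a + b) = f \<sigma> a + f \<sigma> b" and "\<And>\<sigma>. f \<sigma> 0 = 0"
  shows "linear_extension f (c + d) = linear_extension f c + linear_extension f d"
proof -
  let ?S = "Poly_Mapping.keys c \<union> Poly_Mapping.keys d"
  have "Poly_Mapping.keys (c + d) \<subseteq> ?S"
    by (rule Poly_Mapping.keys_add)
  then show ?thesis
    using assms by (simp add: linear_extension_superset[where S = ?S] lookup_add sum.distrib)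
qed

lemma boundary_linear_extension:
  "boundary = linear_extension
     (\<lambda>\<sigma> a. \<Sum>v\<in>\<sigma>. Poly_Mapping.single (\<sigma> - {v}) (incidence_sign \<sigma> v * a))"
  by (rule ext) (simp add: boundary_def linear_extension_def)

lemma boundary_single:
  "boundary (Poly_Mapping.single \<sigma> a) =
     (\<Sum>v\<in>\<sigma>. Poly_Mapping.single (\<sigma> - {v}) (incidence_sign \<sigma> v * a))"
  unfolding boundary_linear_extension by (subst linear_extension_single) auto

lemma boundary_add: "boundary (c + d) = boundary c + boundary d"
  unfolding boundary_linear_extension
  by (rule linear_extension_add) (auto simp: distrib_left single_add sum.distrib)

lemma boundary_0: "boundary 0 = 0"
  by (simp add: boundary_def)

lemma boundary_uminus: "boundary (- c) = - boundary c"
  using boundary_add[of c "- c"] by (simp add: boundary_0 eq_neg_iff_add_eq_0 add.commute)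

lemma boundary_diff: "boundary (c - d) = boundary c - boundary d"
  using boundary_add[of c "- d"] by (simp add: boundary_uminus)

text \<open>The chain-level join with the apex \<open>v\<close>. The incidence sign of \<open>v\<close>
  makes \<open>c\<close> occur with coefficient one in the boundary of its cone.\<close>

definition cone :: "'a \<Rightarrow> ('a set \<Rightarrow>\<^sub>0 'k::field) \<Rightarrow> ('a set \<Rightarrow>\<^sub>0 'k)" where
  "cone v = linear_extension
     (\<lambda>\<sigma> a. Poly_Mapping.single (insert v \<sigma>) (incidence_sign (insert v \<sigma>) v * a))"

lemma cone_single:
  "cone v (Poly_Mapping.single \<sigma> a) =
     Poly_Mapping.single (insert v \<sigma>) (incidence_sign (insert v \<sigma>) v * a)"
  unfolding cone_def by (subst linear_extension_single) auto

lemma cone_add: "cone v (c + d) = cone v c + cone v d"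
  unfolding cone_def by (rule linear_extension_add) (auto simp: distrib_left single_add)

lemma cone_0: "cone v 0 = 0"
  by (simp add: cone_def linear_extension_def)

lemma cone_uminus: "cone v (- c) = - cone v c"
  using cone_add[of v c "- c"] by (simp add: cone_0 eq_neg_iff_add_eq_0 add.commute)

lemma cone_sum: "cone v (sum f A) = (\<Sum>x\<in>A. cone v (f x))"
  by (induction A rule: infinite_finite_induct) (auto simp: cone_0 cone_add)

lemma sum_singles:
  "(\<Sum>\<sigma>\<in>Poly_Mapping.keys c. Poly_Mapping.single \<sigma> (Poly_Mapping.lookup c \<sigma>)) = c"
proof (rule poly_mapping_eqI)
  fix \<tau>
  show "Poly_Mapping.lookup (\<Sum>\<sigma>\<in>Poly_Mapping.keys c.
      Poly_Mapping.single \<sigma> (Poly_Mapping.lookup c \<sigma>)) \<tau> = Poly_Mapping.lookup c \<tau>"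
    by (simp add: lookup_sum lookup_single when_def in_keys_iff)
qed

text \<open>Identities between additive operators only have to be checked on multiples of single faces.\<close>

lemma chain_induct [consumes 1, case_names zero single add]:
  assumes "Poly_Mapping.keys c \<subseteq> S"
    and "P 0"
    and "\<And>\<sigma> a. \<sigma> \<in> S \<Longrightarrow> P (Poly_Mapping.single \<sigma> a)"
    and "\<And>c d. P c \<Longrightarrow> P d \<Longrightarrow> P (c + d)"
  shows "P (c :: 'b \<Rightarrow>\<^sub>0 'k::field)"
proof -
  have "P (\<Sum>\<sigma>\<in>A. Poly_Mapping.single \<sigma> (Poly_Mapping.lookup c \<sigma>))" if "finite A" "A \<subseteq> S" for A
    using that by (induction A rule: finite_induct) (auto intro!: assms(2-4))
  from this[OF finite_keys assms(1)] show ?thesis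
    by (simp add: sum_singles)
qed

lemma chains_0: "0 \<in> chains \<Delta> i"
  by (simp add: chains_def)

lemma chains_add: "c \<in> chains \<Delta> i \<Longrightarrow> d \<in> chains \<Delta> i \<Longrightarrow> c + d \<in> chains \<Delta> i"
  using Poly_Mapping.keys_add[of c d] by (fastforce simp: chains_def)

lemma chains_uminus: "c \<in> chains \<Delta> i \<Longrightarrow> - c \<in> chains \<Delta> i"
  by (auto simp: chains_def in_keys_iff)

lemma chains_diff: "c \<in> chains \<Delta> i \<Longrightarrow> d \<in> chains \<Delta> i \<Longrightarrow> c - d \<in> chains \<Delta> i"
  using chains_add[OF _ chains_uminus, of c \<Delta> i d] by simp

lemma chains_single: "\<sigma> \<in> \<Delta> \<Longrightarrow> face_dim \<sigma> = i \<Longrightarrow> Poly_Mapping.single \<sigma> a \<in> chains \<Delta> i"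
  by (simp add: chains_def)

lemma chains_sum: "(\<And>x. x \<in> A \<Longrightarrow> f x \<in> chains \<Delta> i) \<Longrightarrow> sum f A \<in> chains \<Delta> i"
  by (induction A rule: infinite_finite_induct) (auto simp: chains_0 chains_add)

lemma chains_mono: "\<Delta> \<subseteq> \<Delta>' \<Longrightarrow> chains \<Delta> i \<subseteq> chains \<Delta>' i"
  by (auto simp: chains_def)

lemma face_dim_remove: "finite \<sigma> \<Longrightarrow> v \<in> \<sigma> \<Longrightarrow> face_dim (\<sigma> - {v}) = face_dim \<sigma> - 1"
  using card_gt_0_iff[of \<sigma>] by (auto simp: face_dim_def)

lemma boundary_chains:
  assumes "simplicial_complex \<Delta>" and "c \<in> chains \<Delta> i"
  shows "boundary c \<in> chains \<Delta> (i - 1)"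
proof -
  have "Poly_Mapping.keys c \<subseteq> {\<sigma> \<in> \<Delta>. face_dim \<sigma> = i}"
    using assms(2) by (simp add: chains_def)
  then show ?thesis
  proof (induction rule: chain_induct)
    case (single \<sigma> a)
    then show ?case
      unfolding boundary_single
      by (intro chains_sum chains_single)
        (auto simp: face_dim_remove complexD(1)[OF assms(1)] intro: complexD(2)[OF assms(1)])
  qed (simp_all add: boundary_0 chains_0 boundary_add chains_add)
qed

lemma incidence_sign_square: "incidence_sign \<sigma> v * incidence_sign \<sigma> v = (1 :: 'k::field)"
  by (simp add: incidence_sign_def flip: power_add)

text \<open>Of two distinct vertices the larger one changes its position when the other is
  inserted, the smaller one does not.\<close>

lemma incidence_sign_swap:
  assumes "finite \<sigma>" and "w \<in> \<sigma>" and "v \<notin> \<sigma>"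
  shows "incidence_sign (insert v \<sigma>) v * incidence_sign (insert v \<sigma>) w =
     - (incidence_sign \<sigma> w * incidence_sign (insert v (\<sigma> - {w})) v :: 'k::field)"
proof -
  have lin: "linear_order (vertex_order :: 'a rel)"
    by (rule linear_order_vertex_order)
  have "v \<noteq> w"
    using assms by auto
  define L where "L = (\<lambda>A x. {y \<in> A. y \<noteq> x \<and> (y, x) \<in> (vertex_order :: 'a rel)})"
  have sgn: "incidence_sign A x = ((- 1) ^ card (L A x) :: 'k)" for A x
    by (simp add: incidence_sign_def L_def)
  have Lv: "L (insert v A) v = L A v" for A
    by (auto simp: L_def)
  have fin: "finite (L A x)" if "A \<subseteq> \<sigma>" for A x
    using assms(1) that by (auto simp: L_def intro: finite_subset)
  consider (vw) "(v, w) \<in> vertex_order" "(w, v) \<notin> vertex_order"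
    | (wv) "(w, v) \<in> vertex_order" "(v, w) \<notin> vertex_order"
    using lin \<open>v \<noteq> w\<close>
    unfolding linear_order_on_def partial_order_on_def total_on_def antisym_def by blast
  then show ?thesis
  proof cases
    case vw
    have "L (insert v \<sigma>) w = insert v (L \<sigma> w)"
      using vw \<open>v \<noteq> w\<close> by (auto simp: L_def)
    moreover have "v \<notin> L \<sigma> w"
      using assms by (auto simp: L_def)
    moreover have "L (\<sigma> - {w}) v = L \<sigma> v"
      using vw by (auto simp: L_def)
    ultimately show ?thesis
      using fin[of \<sigma> w] by (simp add: sgn Lv)
  next
    case wv
    have "L (insert v \<sigma>) w = L \<sigma> w"
      using wv by (auto simp: L_def)
    moreover have "L \<sigma> v = insert w (L (\<sigma> - {w}) v)"
      using wv assms \<open>v \<noteq> w\<close> by (auto simp: L_def)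
    moreover have "w \<notin> L (\<sigma> - {w}) v"
      by (auto simp: L_def)
    ultimately show ?thesis
      using fin[of "\<sigma> - {w}" v] by (simp add: sgn Lv)
  qed
qed

text \<open>Removing the apex gives back \<open>c\<close>, because the sign of \<open>v\<close> occurs
  twice. Removing another vertex gives a face of the cone over the boundary, with the opposite
  sign by the exchange rule for incidence signs.\<close>

lemma boundary_cone:
  assumes "Poly_Mapping.keys c \<subseteq> {\<sigma>. finite \<sigma> \<and> v \<notin> \<sigma>}"
  shows "boundary (cone v c) = c - cone v (boundary c)"
  using assms
proof (induction rule: chain_induct)
  case zero
  show ?case
    by (simp add: cone_0 boundary_0)
next
  case (add c d)
  then show ?case
    by (simp add: cone_add boundary_add)
next
  case (single \<sigma> a)
  then have fin: "finite \<sigma>" and v: "v \<notin> \<sigma>"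
    by auto
  let ?s = "incidence_sign (insert v \<sigma>) v :: 'b"
  have "boundary (cone v (Poly_Mapping.single \<sigma> a)) =
      Poly_Mapping.single \<sigma> (?s * (?s * a)) +
      (\<Sum>w\<in>\<sigma>. Poly_Mapping.single (insert v \<sigma> - {w}) (incidence_sign (insert v \<sigma>) w * (?s * a)))"
    using fin v by (simp add: cone_single boundary_single insert_Diff_if)
  also have "Poly_Mapping.single \<sigma> (?s * (?s * a)) = Poly_Mapping.single \<sigma> a"
    by (simp add: incidence_sign_square flip: mult.assoc)
  also have "(\<Sum>w\<in>\<sigma>. Poly_Mapping.single (insert v \<sigma> - {w})
        (incidence_sign (insert v \<sigma>) w * (?s * a))) =
      (\<Sum>w\<in>\<sigma>. - cone v (Poly_Mapping.single (\<sigma> - {w}) (incidence_sign \<sigma> w * a)))"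
  proof (rule sum.cong)
    fix w assume w: "w \<in> \<sigma>"
    have "insert v \<sigma> - {w} = insert v (\<sigma> - {w})"
      using w v by auto
    moreover have "incidence_sign (insert v \<sigma>) w * (?s * a) =
        - (incidence_sign (insert v (\<sigma> - {w})) v * (incidence_sign \<sigma> w * a))"
      using incidence_sign_swap[OF fin w v, where 'k = 'b] by (simp add: algebra_simps)
    ultimately show "Poly_Mapping.single (insert v \<sigma> - {w})
        (incidence_sign (insert v \<sigma>) w * (?s * a)) =
        - cone v (Poly_Mapping.single (\<sigma> - {w}) (incidence_sign \<sigma> w * a))"
      by (simp add: cone_single single_uminus)
  qed simp
  also have "\<dots> = - cone v (boundary (Poly_Mapping.single \<sigma> a))"
    by (simp add: boundary_single cone_sum sum_negf)
  finally show ?case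
    by simp
qed

lemma lookup_cone:
  assumes "Poly_Mapping.keys c \<subseteq> {\<sigma>. v \<notin> \<sigma>}" and "v \<notin> \<tau>"
  shows "Poly_Mapping.lookup (cone v c) (insert v \<tau>) =
    incidence_sign (insert v \<tau>) v * Poly_Mapping.lookup c \<tau>"
  using assms(1)
proof (induction rule: chain_induct)
  case (single \<sigma> a)
  then have "insert v \<sigma> = insert v \<tau> \<longleftrightarrow> \<sigma> = \<tau>"
    using assms(2) by auto
  then show ?case
    by (auto simp: cone_single lookup_single when_def)
qed (auto simp: cone_0 cone_add lookup_add distrib_left)

lemma keys_cone: "Poly_Mapping.keys (cone v c) \<subseteq> {\<sigma>. v \<in> \<sigma>}"
  unfolding cone_def linear_extension_def
  by (rule order.trans[OF Poly_Mapping.keys_sum]) auto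

text \<open>All faces in a cone contain the apex, and distinct faces avoiding \<open>v\<close> have
  distinct cones.\<close>

lemma cone_eq_avoiding:
  assumes "Poly_Mapping.keys c \<subseteq> {\<sigma>. v \<notin> \<sigma>}" and "Poly_Mapping.keys d \<subseteq> {\<sigma>. v \<notin> \<sigma>}"
    and "cone v c = d"
  shows "c = 0" and "d = 0"
proof -
  have "Poly_Mapping.keys d \<subseteq> {}"
    using keys_cone[of v c] assms(2) unfolding assms(3) by blast
  then show "d = 0"
    by simp
  show "c = 0"
  proof (rule poly_mapping_eqI)
    fix \<tau>
    have "Poly_Mapping.lookup c \<tau> = 0" if "v \<notin> \<tau>"
      using lookup_cone[OF assms(1) that] assms(3) \<open>d = 0\<close>
      by (simp add: incidence_sign_def)
    moreover have "Poly_Mapping.lookup c \<tau> = 0" if "v \<in> \<tau>"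
      using assms(1) that by (auto simp: in_keys_iff)
    ultimately show "Poly_Mapping.lookup c \<tau> = Poly_Mapping.lookup 0 \<tau>"
      by auto
  qed
qed

text \<open>The boundaries form an additive group, so a coset is trivial exactly when its representative
  is a boundary.\<close>

lemma homology_vanishes_iff:
  "homology_vanishes (K :: 'k::field itself) \<Delta> i \<longleftrightarrow>
     (reduced_cycles \<Delta> i :: ('a set \<Rightarrow>\<^sub>0 'k) set) \<subseteq> reduced_boundaries \<Delta> i"
proof -
  let ?Z = "reduced_cycles \<Delta> i :: ('a set \<Rightarrow>\<^sub>0 'k) set"
  let ?B = "reduced_boundaries \<Delta> i :: ('a set \<Rightarrow>\<^sub>0 'k) set"
  have B0: "0 \<in> ?B"
    unfolding reduced_boundaries_def by (metis boundary_0 chains_0 image_eqI)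
  have Z0: "0 \<in> ?Z"
    by (simp add: reduced_cycles_def boundary_0 chains_0)
  have Badd: "x + y \<in> ?B" if "x \<in> ?B" "y \<in> ?B" for x y
    using that unfolding reduced_boundaries_def
    by (auto simp flip: boundary_add intro!: imageI chains_add)
  have Bdiff: "x - y \<in> ?B" if "x \<in> ?B" "y \<in> ?B" for x y
    using that unfolding reduced_boundaries_def
    by (auto simp flip: boundary_diff intro!: imageI chains_diff)
  have coset: "(\<lambda>b. z + b) ` ?B = ?B \<longleftrightarrow> z \<in> ?B" for z
  proof
    assume "(\<lambda>b. z + b) ` ?B = ?B"
    then show "z \<in> ?B"
      using imageI[OF B0, of "\<lambda>b. z + b"] by simp
  next
    assume z: "z \<in> ?B"
    have "x \<in> (\<lambda>b. z + b) ` ?B" if "x \<in> ?B" for x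
      using Bdiff[OF that z] by (intro image_eqI[of _ _ "x - z"]) auto
    then show "(\<lambda>b. z + b) ` ?B = ?B"
      using Badd[OF z] by auto
  qed
  have "homology_vanishes K \<Delta> i \<longleftrightarrow> (\<forall>z\<in>?Z. (\<lambda>b. z + b) ` ?B = ?B)"
    unfolding homology_vanishes_def reduced_homology_def using Z0 by blast
  then show ?thesis
    unfolding coset by blast
qed

text \<open>The faces through \<open>v\<close> are the cones over the faces of the link of
  \<open>v\<close>.\<close>

lemma chain_split:
  assumes "simplicial_complex \<Delta>" and "z \<in> chains \<Delta> i"
  shows "\<exists>z0 w. z0 \<in> chains (deletion \<Delta> v) i \<and> w \<in> chains (link \<Delta> {v}) (i - 1) \<and>
    z = z0 + cone v (w :: 'a set \<Rightarrow>\<^sub>0 'k::field)"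
proof -
  have "Poly_Mapping.keys z \<subseteq> {\<sigma> \<in> \<Delta>. face_dim \<sigma> = i}"
    using assms(2) by (simp add: chains_def)
  then show ?thesis
  proof (induction rule: chain_induct)
    case zero
    show ?case
      by (rule exI[of _ 0], rule exI[of _ 0]) (simp add: chains_0 cone_0)
  next
    case (single \<sigma> a)
    show ?case
    proof (cases "v \<in> \<sigma>")
      case False
      then show ?thesis
        using single
        by (intro exI[of _ "Poly_Mapping.single \<sigma> a"] exI[of _ 0])
          (auto simp: chains_0 cone_0 deletion_def intro!: chains_single)
    next
      case True
      have "\<sigma> - {v} \<in> link \<Delta> {v}"
        using single True complexD(2)[OF assms(1), of \<sigma> "\<sigma> - {v}"]
        by (auto simp: link_def insert_absorb)
      moreover have "face_dim (\<sigma> - {v}) = i - 1"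
        using single True complexD(1)[OF assms(1)] by (simp add: face_dim_remove)
      moreover have "Poly_Mapping.single \<sigma> a =
          cone v (Poly_Mapping.single (\<sigma> - {v}) (incidence_sign \<sigma> v * a))"
        using True
        by (simp add: cone_single insert_absorb incidence_sign_square flip: mult.assoc)
      ultimately show ?thesis
        by (intro exI[of _ 0] exI[of _ "Poly_Mapping.single (\<sigma> - {v}) (incidence_sign \<sigma> v * a)"])
          (auto simp: chains_0 intro!: chains_single)
    qed
  next
    case (add c d)
    then obtain c0 cw d0 dw where
      "c0 \<in> chains (deletion \<Delta> v) i" "cw \<in> chains (link \<Delta> {v}) (i - 1)" "c = c0 + cone v cw"
      "d0 \<in> chains (deletion \<Delta> v) i" "dw \<in> chains (link \<Delta> {v}) (i - 1)" "d = d0 + cone v dw"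
      by blast
    then show ?case
      by (intro exI[of _ "c0 + d0"] exI[of _ "cw + dw"]) (auto simp: cone_add chains_add)
  qed
qed

lemma cone_chains:
  assumes "simplicial_complex \<Delta>" and "w \<in> chains (link \<Delta> {v}) i"
  shows "cone v w \<in> chains \<Delta> (i + 1)"
proof -
  have "Poly_Mapping.keys w \<subseteq> {\<sigma> \<in> link \<Delta> {v}. face_dim \<sigma> = i}"
    using assms(2) by (simp add: chains_def)
  then show ?thesis
  proof (induction rule: chain_induct)
    case (single \<sigma> a)
    then show ?case
      unfolding cone_single using complexD(1)[OF assms(1)]
      by (intro chains_single) (auto simp: link_def face_dim_def)
  qed (auto simp: cone_0 chains_0 cone_add chains_add)
qed

lemma keys_chains_avoid:
  assumes "simplicial_complex \<Delta>"
  shows "c \<in> chains (deletion \<Delta> v) i \<Longrightarrow> Poly_Mapping.keys c \<subseteq> {\<sigma>. finite \<sigma> \<and> v \<notin> \<sigma>}"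
    and "c \<in> chains (link \<Delta> {v}) i \<Longrightarrow> Poly_Mapping.keys c \<subseteq> {\<sigma>. finite \<sigma> \<and> v \<notin> \<sigma>}"
  using complexD(1)[OF assms] by (auto simp: chains_def deletion_def link_def)

text \<open>In the boundary of \<open>z0 + cone v w\<close> the faces through \<open>v\<close> are those
  of the cone over the boundary of \<open>w\<close>, and the other faces are those of
  \<open>boundary z0 + w\<close>. For a cycle both parts vanish.\<close>

lemma cycle_split:
  assumes "simplicial_complex \<Delta>" and "z \<in> reduced_cycles \<Delta> i"
  shows "\<exists>z0 w. z0 \<in> chains (deletion \<Delta> v) i \<and> w \<in> reduced_cycles (link \<Delta> {v}) (i - 1) \<and>
    z = z0 + cone v (w :: 'a set \<Rightarrow>\<^sub>0 'k::field) \<and> boundary z0 = - w"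
proof -
  obtain z0 w where z0: "z0 \<in> chains (deletion \<Delta> v) i" and w: "w \<in> chains (link \<Delta> {v}) (i - 1)"
    and z: "z = z0 + cone v w"
    using chain_split[OF assms(1)] assms(2) unfolding reduced_cycles_def by blast
  have "boundary z0 + w - cone v (boundary w) = boundary z"
    unfolding z boundary_add boundary_cone[OF keys_chains_avoid(2)[OF assms(1) w]] by simp
  then have eq: "cone v (boundary w) = boundary z0 + w"
    using assms(2) by (simp add: reduced_cycles_def)
  have bw: "boundary w \<in> chains (link \<Delta> {v}) (i - 1 - 1)"
    using boundary_chains[OF complex_link[OF assms(1)] w] .
  have bz: "boundary z0 \<in> chains (deletion \<Delta> v) (i - 1)"
    using boundary_chains[OF complex_deletion[OF assms(1)] z0] .
  have "Poly_Mapping.keys (boundary z0 + w) \<subseteq> {\<sigma>. v \<notin> \<sigma>}"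
    using keys_chains_avoid(1)[OF assms(1) bz] keys_chains_avoid(2)[OF assms(1) w]
      Poly_Mapping.keys_add[of "boundary z0" w] by blast
  then have "boundary w = 0" "boundary z0 + w = 0"
    using cone_eq_avoiding[OF _ _ eq] keys_chains_avoid(2)[OF assms(1) bw] by blast+
  then show ?thesis
    using z0 w z by (auto simp: reduced_cycles_def eq_neg_iff_add_eq_0)
qed

text \<open>This is the piece of the Mayer--Vietoris sequence for the covering of \<open>\<Delta>\<close>
  by the deletion of \<open>v\<close> and the cone over the link of \<open>v\<close>. If
  \<open>w\<close> is the boundary of \<open>u\<close> in the link, then adding the boundary of
  the cone over \<open>u\<close> moves the cycle off \<open>v\<close>, where it bounds as well.\<close>

lemma homology_vanishes_deletion_link:
  assumes "simplicial_complex \<Delta>"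
    and "homology_vanishes K (deletion \<Delta> v) i"
    and "homology_vanishes K (link \<Delta> {v}) (i - 1)"
  shows "homology_vanishes (K :: 'k::field itself) \<Delta> i"
  unfolding homology_vanishes_iff
proof
  fix z :: "'a set \<Rightarrow>\<^sub>0 'k"
  assume "z \<in> reduced_cycles \<Delta> i"
  then obtain z0 w where z0: "z0 \<in> chains (deletion \<Delta> v) i"
    and w: "w \<in> reduced_cycles (link \<Delta> {v}) (i - 1)"
    and z: "z = z0 + cone v w" and bz0: "boundary z0 = - w"
    using cycle_split[OF assms(1)] by blast
  obtain u where u: "u \<in> chains (link \<Delta> {v}) i" and wu: "w = boundary u"
    using assms(3) w unfolding homology_vanishes_iff reduced_boundaries_def by auto
  have "link \<Delta> {v} \<subseteq> deletion \<Delta> v"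
    by (auto simp: link_def deletion_def)
  then have "z0 + u \<in> chains (deletion \<Delta> v) i"
    using z0 u chains_mono by (blast intro: chains_add)
  then have "z0 + u \<in> reduced_cycles (deletion \<Delta> v) i"
    using bz0 wu by (simp add: reduced_cycles_def boundary_add)
  then obtain t where t: "t \<in> chains (deletion \<Delta> v) (i + 1)" and zut: "z0 + u = boundary t"
    using assms(2) unfolding homology_vanishes_iff reduced_boundaries_def by auto
  have "boundary (t - cone v u) = z"
    unfolding boundary_diff boundary_cone[OF keys_chains_avoid(2)[OF assms(1) u]]
    by (simp add: z wu flip: zut)
  moreover have "t - cone v u \<in> chains \<Delta> (i + 1)"
    using t cone_chains[OF assms(1) u] chains_mono[of "deletion \<Delta> v" \<Delta>]
    by (intro chains_diff) (auto simp: deletion_def)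
  ultimately show "z \<in> reduced_boundaries \<Delta> i"
    unfolding reduced_boundaries_def by blast
qed

text \<open>If \<open>v\<close> can be added to every face, then the cone over the part of a cycle that
  avoids \<open>v\<close> has that cycle as its boundary.\<close>

lemma homology_vanishes_cone:
  assumes "simplicial_complex \<Delta>" and "link \<Delta> {v} = deletion \<Delta> v"
  shows "homology_vanishes (K :: 'k::field itself) \<Delta> i"
  unfolding homology_vanishes_iff
proof
  fix z :: "'a set \<Rightarrow>\<^sub>0 'k"
  assume "z \<in> reduced_cycles \<Delta> i"
  then obtain z0 w where z0: "z0 \<in> chains (deletion \<Delta> v) i"
    and z: "z = z0 + cone v w" and bz0: "boundary z0 = - w"
    using cycle_split[OF assms(1)] by blast
  have "boundary (cone v z0) = z"
    unfolding boundary_cone[OF keys_chains_avoid(1)[OF assms(1) z0]]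
    by (simp add: z bz0 cone_uminus)
  moreover have "cone v z0 \<in> chains \<Delta> (i + 1)"
    using cone_chains[OF assms(1), of z0 v i] z0 assms(2) by simp
  ultimately show "z \<in> reduced_boundaries \<Delta> i"
    unfolding reduced_boundaries_def by blast
qed

lemma homology_vanishes_below:
  assumes "i < - 1"
  shows "homology_vanishes (K :: 'k::field itself) \<Delta> i"
proof -
  have "reduced_cycles \<Delta> i \<subseteq> ({0} :: ('a set \<Rightarrow>\<^sub>0 'k) set)"
    using assms by (auto simp: reduced_cycles_def chains_def face_dim_def)
  moreover have "(0 :: 'a set \<Rightarrow>\<^sub>0 'k) \<in> reduced_boundaries \<Delta> i"
    unfolding reduced_boundaries_def by (metis boundary_0 chains_0 image_eqI)
  ultimately show ?thesis
    unfolding homology_vanishes_iff by blast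
qed

lemma homology_irrelevant_complex: "\<not> homology_vanishes (K :: 'k::field itself) {{}} (- 1)"
proof
  assume vanish: "homology_vanishes K {{} :: 'a set} (- 1)"
  let ?c = "Poly_Mapping.single {} 1 :: 'a set \<Rightarrow>\<^sub>0 'k"
  have "?c \<in> reduced_cycles {{}} (- 1)"
    by (simp add: reduced_cycles_def boundary_single chains_single face_dim_def)
  then obtain d :: "'a set \<Rightarrow>\<^sub>0 'k" where "d \<in> chains {{}} 0" "?c = boundary d"
    using vanish unfolding homology_vanishes_iff reduced_boundaries_def by auto
  moreover have "{\<sigma> \<in> {{} :: 'a set}. face_dim \<sigma> = 0} = {}"
    by (auto simp: face_dim_def)
  then have "d = 0"
    using \<open>d \<in> chains {{}} 0\<close>
    by (simp only: chains_def mem_Collect_eq subset_empty keys_eq_empty)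
  ultimately have "?c = 0"
    by (simp add: boundary_0)
  then have "Poly_Mapping.lookup ?c {} = 0"
    by simp
  then show False
    by simp
qed


section \<open>Complexes that are Cohen--Macaulay up to a dimension\<close>

text \<open>In terms of commutative algebra, the Stanley--Reisner ring of a nonempty
  \<open>\<Delta>\<close> has depth at least \<open>d + 1\<close>. A complex of dimension
  \<open>d\<close> with this property is Cohen--Macaulay, but the number \<open>d\<close> may
  also be smaller than the dimension, which makes the notion suitable for induction on non-pure
  complexes.\<close>

definition cm_upto :: "'k::field itself \<Rightarrow> 'a set set \<Rightarrow> int \<Rightarrow> bool" where
  "cm_upto K \<Delta> d \<longleftrightarrow> (\<forall>\<sigma>\<in>\<Delta>. \<forall>i<d - int (card \<sigma>). homology_vanishes K (link \<Delta> \<sigma>) i)"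

lemma cm_upto_empty: "cm_upto K {} d"
  by (simp add: cm_upto_def)

lemma cm_upto_mono: "cm_upto K \<Delta> d \<Longrightarrow> d' \<le> d \<Longrightarrow> cm_upto K \<Delta> d'"
  unfolding cm_upto_def by (meson diff_right_mono less_le_trans)

text \<open>For a face \<open>\<sigma>\<close> through \<open>v\<close> the link is a link in the link of
  \<open>v\<close>, where the dimension and the size of the face both drop by one. For the other
  faces, taking the link of \<open>\<sigma>\<close> commutes with the deletion and with the link
  of \<open>v\<close>, so the statement about homology applies to the link of
  \<open>\<sigma>\<close>.\<close>

lemma cm_upto_deletion_link:
  assumes "simplicial_complex \<Delta>"
    and "cm_upto K (deletion \<Delta> v) d" and "cm_upto K (link \<Delta> {v}) (d - 1)"
  shows "cm_upto K \<Delta> d"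
  unfolding cm_upto_def
proof (intro ballI allI impI)
  fix \<sigma> i
  assume \<sigma>: "\<sigma> \<in> \<Delta>" and i: "i < d - int (card \<sigma>)"
  show "homology_vanishes K (link \<Delta> \<sigma>) i"
  proof (cases "v \<in> \<sigma>")
    case True
    have eq: "link \<Delta> \<sigma> = link (link \<Delta> {v}) (\<sigma> - {v})"
    proof (rule set_eqI)
      fix \<tau>
      have un: "\<tau> \<union> (\<sigma> - {v}) \<union> {v} = \<tau> \<union> \<sigma>"
        using True by auto
      have disj: "\<tau> \<inter> (\<sigma> - {v}) = {} \<and> \<tau> \<inter> {v} = {} \<and> (\<tau> \<union> (\<sigma> - {v})) \<inter> {v} = {} \<longleftrightarrow> \<tau> \<inter> \<sigma> = {}"
        using True by auto
      have sub: "\<tau> \<union> \<sigma> \<in> \<Delta> \<Longrightarrow> \<tau> \<union> {v} \<in> \<Delta> \<and> \<tau> \<union> (\<sigma> - {v}) \<in> \<Delta> \<and> \<tau> \<in> \<Delta>"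
        using True complexD(2)[OF assms(1), of "\<tau> \<union> \<sigma>"] by (simp add: le_supI1 le_supI2)
      show "\<tau> \<in> link \<Delta> \<sigma> \<longleftrightarrow> \<tau> \<in> link (link \<Delta> {v}) (\<sigma> - {v})"
        unfolding link_def mem_Collect_eq un using disj sub by argo
    qed
    have "\<sigma> - {v} \<in> link \<Delta> {v}"
      using \<sigma> True complexD(2)[OF assms(1), of \<sigma> "\<sigma> - {v}"]
      by (auto simp: link_def insert_absorb)
    moreover have "card \<sigma> = Suc (card (\<sigma> - {v}))"
      using card.remove[of \<sigma> v] True complexD(1)[OF assms(1) \<sigma>] by simp
    then have "i < d - 1 - int (card (\<sigma> - {v}))"
      using i by simp
    ultimately show ?thesis
      using assms(3) unfolding cm_upto_def eq by blast
  next
    case False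
    have "\<sigma> \<in> deletion \<Delta> v"
      using \<sigma> False by (simp add: deletion_def)
    then have del: "homology_vanishes K (link (deletion \<Delta> v) \<sigma>) i"
      using assms(2) i unfolding cm_upto_def by blast
    have eq_del: "link (deletion \<Delta> v) \<sigma> = deletion (link \<Delta> \<sigma>) v"
      using False by (auto simp: link_def deletion_def)
    show ?thesis
    proof (cases "insert v \<sigma> \<in> \<Delta>")
      case False
      have "deletion (link \<Delta> \<sigma>) v = link \<Delta> \<sigma>"
        using False complexD(2)[OF assms(1), of _ "insert v \<sigma>"]
        by (fastforce simp: deletion_def link_def)
      then show ?thesis
        using del eq_del by simp
    next
      case True
      have "link (link \<Delta> {v}) \<sigma> = link (link \<Delta> \<sigma>) {v}"
      proof (rule set_eqI)
        fix \<tau>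
        show "\<tau> \<in> link (link \<Delta> {v}) \<sigma> \<longleftrightarrow> \<tau> \<in> link (link \<Delta> \<sigma>) {v}"
          using \<open>v \<notin> \<sigma>\<close> complexD(2)[OF assms(1), of "insert v (\<tau> \<union> \<sigma>)" "insert v \<tau>"]
            complexD(2)[OF assms(1), of "insert v (\<tau> \<union> \<sigma>)" "\<tau> \<union> \<sigma>"]
          by (auto simp: link_def)
      qed
      moreover have "\<sigma> \<in> link \<Delta> {v}"
        using True \<sigma> \<open>v \<notin> \<sigma>\<close> by (auto simp: link_def)
      then have "homology_vanishes K (link (link \<Delta> {v}) \<sigma>) (i - 1)"
        using assms(3) i unfolding cm_upto_def by auto
      ultimately show ?thesis
        using homology_vanishes_deletion_link[OF complex_link[OF assms(1)]] del eq_del by metis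
    qed
  qed
qed

lemma cm_upto_Pow:
  assumes "finite W"
  shows "cm_upto K (Pow W) (int (card W) - 1)"
  unfolding cm_upto_def
proof (intro ballI allI impI)
  fix \<sigma> i
  assume \<sigma>: "\<sigma> \<in> Pow W" and i: "i < int (card W) - 1 - int (card \<sigma>)"
  have link: "link (Pow W) \<sigma> = Pow (W - \<sigma>)"
    using \<sigma> by (auto simp: link_def)
  show "homology_vanishes K (link (Pow W) \<sigma>) i"
  proof (cases "\<sigma> = W")
    case True
    then show ?thesis
      using i by (intro homology_vanishes_below) simp
  next
    case False
    then obtain v where "v \<in> W - \<sigma>"
      using \<sigma> by auto
    then have "link (Pow (W - \<sigma>)) {v} = deletion (Pow (W - \<sigma>)) v"
      by (auto simp: link_def deletion_def)
    moreover have "simplicial_complex (Pow (W - \<sigma>))"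
      using assms by (auto simp: simplicial_complex_def intro: finite_subset)
    ultimately show ?thesis
      unfolding link by (rule homology_vanishes_cone[rotated])
  qed
qed

text \<open>The link of a facet consists of the empty face only, and this complex has homology in degree
  \<open>- 1\<close>.\<close>

lemma facet_card:
  assumes "simplicial_complex \<Delta>" and "cm_upto (K :: 'k::field itself) \<Delta> d" and "facet \<Delta> \<sigma>"
  shows "d + 1 \<le> int (card \<sigma>)"
proof (rule ccontr)
  assume "\<not> ?thesis"
  then have "- 1 < d - int (card \<sigma>)"
    by simp
  moreover have \<sigma>: "\<sigma> \<in> \<Delta>"
    using assms(3) by (simp add: facet_def)
  ultimately have "homology_vanishes K (link \<Delta> \<sigma>) (- 1)"
    using assms(2) unfolding cm_upto_def by blast
  moreover have "link \<Delta> \<sigma> = {{}}"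
  proof -
    have "\<tau> = {}" if "\<tau> \<in> link \<Delta> \<sigma>" for \<tau>
      using that assms(3) unfolding link_def facet_def by blast
    moreover have "{} \<in> link \<Delta> \<sigma>"
      using \<sigma> complexD(2)[OF assms(1) \<sigma>, of "{}"] by (simp add: link_def)
    ultimately show ?thesis
      by blast
  qed
  ultimately show False
    using homology_irrelevant_complex by metis
qed

lemma face_in_facet:
  assumes "finite \<Delta>" and "\<sigma> \<in> \<Delta>"
  shows "\<exists>\<tau>. facet \<Delta> \<tau> \<and> \<sigma> \<subseteq> \<tau>"
proof -
  obtain \<tau> where "\<tau> \<in> \<Delta>" "\<sigma> \<subseteq> \<tau>" "\<forall>\<rho>\<in>\<Delta>. \<tau> \<subseteq> \<rho> \<longrightarrow> \<tau> = \<rho>"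
    using finite_has_maximal2[OF assms] by blast
  then show ?thesis
    unfolding facet_def by blast
qed

lemma cohen_macaulay_if_cm_upto:
  assumes "finite \<Delta>" and "simplicial_complex \<Delta>" and "cm_upto K \<Delta> d"
    and "\<And>\<sigma>. \<sigma> \<in> \<Delta> \<Longrightarrow> int (card \<sigma>) \<le> d + 1"
  shows "cohen_macaulay K \<Delta>"
  unfolding cohen_macaulay_def
proof (intro ballI allI impI)
  fix \<sigma> i
  assume \<sigma>: "\<sigma> \<in> \<Delta>" and i: "i < complex_dim (link \<Delta> \<sigma>)"
  have "complex_dim (link \<Delta> \<sigma>) \<le> d - int (card \<sigma>)"
    unfolding complex_dim_def
  proof (rule Max.boundedI)
    show "finite (face_dim ` link \<Delta> \<sigma>)"
      using assms(1) by (simp add: link_def)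
    have "{} \<in> link \<Delta> \<sigma>"
      using \<sigma> complexD(2)[OF assms(2) \<sigma>, of "{}"] by (simp add: link_def)
    then show "face_dim ` link \<Delta> \<sigma> \<noteq> {}"
      by blast
    fix a assume "a \<in> face_dim ` link \<Delta> \<sigma>"
    then obtain \<tau> where \<tau>: "\<tau> \<in> link \<Delta> \<sigma>" "a = face_dim \<tau>"
      by blast
    then have "card (\<tau> \<union> \<sigma>) = card \<tau> + card \<sigma>"
      using complexD(1)[OF assms(2)] \<sigma> by (intro card_Un_disjoint) (auto simp: link_def)
    moreover have "int (card (\<tau> \<union> \<sigma>)) \<le> d + 1"
      using \<tau> by (intro assms(4)) (simp add: link_def)
    ultimately show "a \<le> d - int (card \<sigma>)"
      using \<tau> by (simp add: face_dim_def)
  qed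
  then show "homology_vanishes K (link \<Delta> \<sigma>) i"
    using assms(3) \<sigma> i unfolding cm_upto_def by force
qed

text \<open>Homology in degree \<open>i\<close> depends only on the faces of dimension \<open>i\<close>
  and \<open>i + 1\<close>.\<close>

lemma cm_upto_skeleton:
  assumes "simplicial_complex \<Delta>" and "cm_upto (K :: 'k::field itself) \<Delta> e" and "d \<le> e"
  shows "cm_upto K {\<tau> \<in> \<Delta>. int (card \<tau>) \<le> d + 1} d"
  unfolding cm_upto_def
proof (intro ballI allI impI)
  let ?S = "{\<tau> \<in> \<Delta>. int (card \<tau>) \<le> d + 1}"
  fix \<sigma> i
  assume \<sigma>: "\<sigma> \<in> ?S" and i: "i < d - int (card \<sigma>)"
  have card: "card (\<tau> \<union> \<sigma>) = card \<tau> + card \<sigma>" if "\<tau> \<in> link \<Delta> \<sigma>" for \<tau>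
    using that \<sigma> complexD(1)[OF assms(1)] by (intro card_Un_disjoint) (auto simp: link_def)
  have eq: "chains (link ?S \<sigma>) j = (chains (link \<Delta> \<sigma>) j :: ('a set \<Rightarrow>\<^sub>0 'k) set)"
    if "j \<le> d - int (card \<sigma>)" for j
  proof -
    have "link ?S \<sigma> \<subseteq> link \<Delta> \<sigma>"
      by (auto simp: link_def)
    moreover have "\<tau> \<in> link ?S \<sigma>" if "\<tau> \<in> link \<Delta> \<sigma>" "face_dim \<tau> = j" for \<tau>
      using that \<open>j \<le> d - int (card \<sigma>)\<close> card[of \<tau>] by (auto simp: link_def face_dim_def)
    ultimately show ?thesis
      unfolding chains_def by blast
  qed
  have "homology_vanishes K (link \<Delta> \<sigma>) i"
    using assms(2,3) \<sigma> i unfolding cm_upto_def by auto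
  then show "homology_vanishes K (link ?S \<sigma>) i"
    using i by (simp add: homology_vanishes_iff reduced_cycles_def reduced_boundaries_def eq)
qed

text \<open>All facets have dimension at least \<open>e\<close>, so up to dimension \<open>e\<close> the
  pure skeleta are the ordinary skeleta.\<close>

lemma cohen_macaulay_pure_skeleton:
  assumes "finite \<Delta>" and "simplicial_complex \<Delta>" and "cm_upto K \<Delta> e" and "d \<le> e"
  shows "cohen_macaulay K (pure_skeleton \<Delta> d)"
proof -
  have eq: "pure_skeleton \<Delta> d = {\<tau> \<in> \<Delta>. int (card \<tau>) \<le> d + 1}"
  proof (intro set_eqI iffI)
    fix \<tau> assume "\<tau> \<in> pure_skeleton \<Delta> d"
    then obtain \<sigma> where "\<sigma> \<in> \<Delta>" "face_dim \<sigma> = d" "\<tau> \<subseteq> \<sigma>"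
      by (auto simp: pure_skeleton_def)
    moreover from this have "\<tau> \<in> \<Delta>" "card \<tau> \<le> card \<sigma>"
      using complexD[OF assms(2)] by (blast intro: card_mono)+
    ultimately show "\<tau> \<in> {\<tau> \<in> \<Delta>. int (card \<tau>) \<le> d + 1}"
      by (simp add: face_dim_def)
  next
    fix \<tau> assume \<tau>: "\<tau> \<in> {\<tau> \<in> \<Delta>. int (card \<tau>) \<le> d + 1}"
    then obtain \<rho> where \<rho>: "facet \<Delta> \<rho>" "\<tau> \<subseteq> \<rho>"
      using face_in_facet[OF assms(1)] by blast
    then have "\<rho> \<in> \<Delta>" and "e + 1 \<le> int (card \<rho>)"
      using facet_card[OF assms(2,3)] by (auto simp: facet_def)
    have "finite \<rho>"
      using complexD(1)[OF assms(2) \<open>\<rho> \<in> \<Delta>\<close>] .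
    have "card \<tau> \<le> nat (d + 1)"
      using \<tau> unfolding mem_Collect_eq by linarith
    have "nat (d + 1) \<le> card \<rho>"
      using \<open>e + 1 \<le> int (card \<rho>)\<close> assms(4) by linarith
    obtain \<sigma> where "\<tau> \<subseteq> \<sigma>" "\<sigma> \<subseteq> \<rho>" "card \<sigma> = nat (d + 1)"
      using exists_subset_between[OF \<open>card \<tau> \<le> nat (d + 1)\<close> \<open>nat (d + 1) \<le> card \<rho>\<close>
          \<rho>(2) \<open>finite \<rho>\<close>] by blast
    have "\<sigma> \<in> \<Delta>"
      by (rule complexD(2)[OF assms(2) \<open>\<rho> \<in> \<Delta>\<close> \<open>\<sigma> \<subseteq> \<rho>\<close>])
    moreover have "face_dim \<sigma> = d"
      using \<tau> \<open>card \<sigma> = nat (d + 1)\<close> by (simp add: face_dim_def)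
    ultimately show "\<tau> \<in> pure_skeleton \<Delta> d"
      unfolding pure_skeleton_def using \<open>\<tau> \<subseteq> \<sigma>\<close> by (intro CollectI bexI conjI)
  qed
  have cx: "simplicial_complex {\<tau> \<in> \<Delta>. int (card \<tau>) \<le> d + 1}"
    unfolding simplicial_complex_def
  proof (intro ballI conjI allI impI)
    fix \<sigma> assume \<sigma>: "\<sigma> \<in> {\<tau> \<in> \<Delta>. int (card \<tau>) \<le> d + 1}"
    then show "finite \<sigma>"
      using complexD(1)[OF assms(2)] by simp
    fix \<tau> assume "\<tau> \<subseteq> \<sigma>"
    then show "\<tau> \<in> {\<tau> \<in> \<Delta>. int (card \<tau>) \<le> d + 1}"
      using \<sigma> complexD(2)[OF assms(2), of \<sigma> \<tau>] card_mono[OF \<open>finite \<sigma>\<close>, of \<tau>] by simp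
  qed
  have fin: "finite {\<tau> \<in> \<Delta>. int (card \<tau>) \<le> d + 1}"
    using assms(1) by simp
  show ?thesis
    unfolding eq by (rule cohen_macaulay_if_cm_upto[OF fin cx cm_upto_skeleton[OF assms(2-4)]]) simp
qed

text \<open>The state of a recursion over the vertices in \<open>U\<close>: those in \<open>S\<close> have
  been put into the face by taking links, those in \<open>R\<close> are undecided, and the
  others have been deleted.\<close>

definition partial_link :: "'a set set \<Rightarrow> 'a set \<Rightarrow> 'a set \<Rightarrow> 'a set \<Rightarrow> 'a set set" where
  "partial_link \<Delta> U S R = {F. F \<inter> S = {} \<and> F \<union> S \<in> \<Delta> \<and> F \<inter> U \<subseteq> R}"

lemma complex_partial_link:
  assumes "simplicial_complex \<Delta>"
  shows "simplicial_complex (partial_link \<Delta> U S R)"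
  unfolding simplicial_complex_def
proof (intro ballI conjI allI impI)
  fix F assume F: "F \<in> partial_link \<Delta> U S R"
  then show "finite F"
    using complexD(1)[OF assms, of "F \<union> S"] by (simp add: partial_link_def)
  fix F' assume "F' \<subseteq> F"
  moreover from this have "F' \<union> S \<subseteq> F \<union> S"
    by blast
  ultimately show "F' \<in> partial_link \<Delta> U S R"
    using F complexD(2)[OF assms, of "F \<union> S" "F' \<union> S"] unfolding partial_link_def by blast
qed

text \<open>Each step decides one vertex of \<open>R\<close>. The recursion stops as soon as only
  \<open>k\<close> vertices of \<open>U\<close> have not been deleted: a further deletion from a
  simplex would lower its dimension.\<close>

lemma cm_upto_partial_link:
  assumes "simplicial_complex \<Delta>" and "finite U"
    and base: "\<And>S R. S \<subseteq> U \<Longrightarrow> R \<subseteq> U \<Longrightarrow> S \<inter> R = {} \<Longrightarrow> k \<le> card (S \<union> R) \<Longrightarrow>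
      card (S \<union> R) = k \<or> R = {} \<Longrightarrow> cm_upto K (partial_link \<Delta> U S R) (d - int (card S))"
    and "S \<subseteq> U" and "R \<subseteq> U" and "S \<inter> R = {}" and "k \<le> card (S \<union> R)"
  shows "cm_upto K (partial_link \<Delta> U S R) (d - int (card S))"
  using assms(4-7)
proof (induction "card R" arbitrary: S R)
  case 0
  then have "R = {}"
    using assms(2) finite_subset[of R U] by simp
  then show ?case
    using 0 by (intro base) auto
next
  case (Suc c)
  show ?case
  proof (cases "card (S \<union> R) = k")
    case True
    then show ?thesis
      using Suc by (intro base) auto
  next
    case False
    obtain r where r: "r \<in> R"
      using Suc.hyps(2) by fastforce
    then have rS: "r \<notin> S" "r \<in> U"
      using Suc.prems by auto
    have fin: "finite R" "finite S"
      by (rule finite_subset[OF Suc.prems(2) assms(2)], rule finite_subset[OF Suc.prems(1) assms(2)])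
    have cR: "c = card (R - {r})"
      using Suc.hyps(2) r fin by simp
    have "S \<union> (R - {r}) = (S \<union> R) - {r}"
      using rS by auto
    then have "card (S \<union> (R - {r})) = card (S \<union> R) - 1"
      using r fin by simp
    then have del: "cm_upto K (partial_link \<Delta> U S (R - {r})) (d - int (card S))"
      using Suc.prems False by (intro Suc.hyps(1)[OF cR]) auto
    have "insert r S \<union> (R - {r}) = S \<union> R"
      using r by auto
    then have link: "cm_upto K (partial_link \<Delta> U (insert r S) (R - {r})) (d - int (card (insert r S)))"
      using Suc.prems rS by (intro Suc.hyps(1)[OF cR]) auto
    have del_eq: "deletion (partial_link \<Delta> U S R) r = partial_link \<Delta> U S (R - {r})"
      using rS by (auto simp: deletion_def partial_link_def)
    have link_eq: "link (partial_link \<Delta> U S R) {r} = partial_link \<Delta> U (insert r S) (R - {r})"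
    proof (rule set_eqI)
      fix F
      show "F \<in> link (partial_link \<Delta> U S R) {r} \<longleftrightarrow>
          F \<in> partial_link \<Delta> U (insert r S) (R - {r})"
        using complexD(2)[OF assms(1), of "insert r (F \<union> S)" "F \<union> S"] rS r
        by (auto simp: link_def partial_link_def)
    qed
    have "d - int (card (insert r S)) = d - int (card S) - 1"
      using rS fin by simp
    then show ?thesis
      using cm_upto_deletion_link[OF complex_partial_link[OF assms(1)], of K U S R r] del link
      unfolding del_eq link_eq by metis
  qed
qed

lemma cm_upto_by_partial_links:
  assumes "simplicial_complex \<Delta>" and "finite U" and "k \<le> card U"
    and "\<And>S R. S \<subseteq> U \<Longrightarrow> R \<subseteq> U \<Longrightarrow> S \<inter> R = {} \<Longrightarrow> k \<le> card (S \<union> R) \<Longrightarrow>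
      card (S \<union> R) = k \<or> R = {} \<Longrightarrow> cm_upto K (partial_link \<Delta> U S R) (d - int (card S))"
  shows "cm_upto K \<Delta> d"
proof -
  have "partial_link \<Delta> U {} U = \<Delta>"
    by (auto simp: partial_link_def)
  moreover have "cm_upto K (partial_link \<Delta> U {} U) (d - int (card ({} :: 'a set)))"
    by (rule cm_upto_partial_link[OF assms(1,2,4)]) (use assms(3) in simp_all)
  ultimately show ?thesis
    by simp
qed


section \<open>Matching numbers of induced subgraphs\<close>

abbreviation nu :: "'a ugraph \<Rightarrow> 'a set \<Rightarrow> nat" where
  "nu H T \<equiv> matching_number (induced_subgraph H T)"

lemma matching_induced:
  "matching (induced_subgraph H T) M \<longleftrightarrow> M \<subseteq> edges H \<and> (\<forall>e\<in>M. e \<subseteq> T) \<and> disjoint M"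
  by (auto simp: matching_def induced_subgraph_def)

lemma edge_card: "finite_simple_graph H \<Longrightarrow> e \<in> edges H \<Longrightarrow> card e = 2"
  and edge_subset: "finite_simple_graph H \<Longrightarrow> e \<in> edges H \<Longrightarrow> e \<subseteq> verts H"
  by (auto simp: finite_simple_graph_def)

lemma edge_neq: "finite_simple_graph H \<Longrightarrow> {u, v} \<in> edges H \<Longrightarrow> u \<noteq> v"
  using edge_card[of H "{u, v}"] by auto

lemma finite_verts: "finite_simple_graph H \<Longrightarrow> finite (verts H)"
  by (simp add: finite_simple_graph_def)

lemma finite_edges: "finite_simple_graph H \<Longrightarrow> finite (edges H)"
  by (rule finite_subset[of _ "Pow (verts H)"]) (auto simp: finite_simple_graph_def)

lemma finite_matching:
  "finite_simple_graph H \<Longrightarrow> matching (induced_subgraph H T) M \<Longrightarrow> finite M"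
  by (auto simp: matching_induced intro: finite_subset finite_edges)

lemma finite_matching_cards:
  assumes "finite_simple_graph H"
  shows "finite {card M | M. matching (induced_subgraph H T) M}"
proof -
  have "{card M | M. matching (induced_subgraph H T) M} \<subseteq> card ` Pow (edges H)"
    by (auto simp: matching_induced)
  then show ?thesis
    using finite_edges[OF assms] by (meson finite_Pow_iff finite_imageI finite_subset)
qed

lemma card_le_nu:
  assumes "finite_simple_graph H" and "matching (induced_subgraph H T) M"
  shows "card M \<le> nu H T"
  unfolding matching_number_def
  using assms(2) by (intro Max_ge finite_matching_cards[OF assms(1)]) blast

lemma maximum_matching:
  assumes "finite_simple_graph H"
  obtains M where "matching (induced_subgraph H T) M" and "card M = nu H T"
proof -
  have "matching (induced_subgraph H T) {}"
    by (simp add: matching_induced)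
  then have "nu H T \<in> {card M | M. matching (induced_subgraph H T) M}"
    unfolding matching_number_def by (intro Max_in finite_matching_cards[OF assms]) blast
  then show ?thesis
    using that by auto
qed

lemma nu_mono:
  assumes "finite_simple_graph H" and "T \<subseteq> T'"
  shows "nu H T \<le> nu H T'"
proof -
  obtain M where M: "matching (induced_subgraph H T) M" "card M = nu H T"
    using maximum_matching[OF assms(1)] .
  have "matching (induced_subgraph H T') M"
    using M(1) assms(2) unfolding matching_induced by blast
  then show ?thesis
    using card_le_nu[OF assms(1)] M(2) by metis
qed

text \<open>Every vertex of \<open>W\<close> meets at most one edge of a matching.\<close>

lemma nu_le_remove:
  assumes "finite_simple_graph H" and "finite W"
  shows "nu H T \<le> card W + nu H (T - W)"
proof -
  obtain M where M: "matching (induced_subgraph H T) M" "card M = nu H T"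
    using maximum_matching[OF assms(1)] .
  have fin: "finite M"
    using finite_matching[OF assms(1) M(1)] .
  let ?M1 = "{e \<in> M. e \<inter> W \<noteq> {}}" and ?M2 = "{e \<in> M. e \<inter> W = {}}"
  have "\<forall>e\<in>?M1. \<exists>w. w \<in> e \<inter> W"
    by blast
  then obtain f where f: "\<And>e. e \<in> ?M1 \<Longrightarrow> f e \<in> e \<inter> W"
    by (metis (no_types, lifting))
  have "inj_on f ?M1"
  proof (rule inj_onI)
    fix d e assume de: "d \<in> ?M1" "e \<in> ?M1" "f d = f e"
    then have "d \<inter> e \<noteq> {}"
      using f[of d] f[of e] by auto
    then show "d = e"
      using disjointD[of M d e] M(1) de by (auto simp: matching_induced)
  qed
  then have "card ?M1 \<le> card W"
    using f assms(2) by (intro card_inj_on_le) auto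
  moreover have "matching (induced_subgraph H (T - W)) ?M2"
    using M(1) by (auto simp: matching_induced intro: pairwise_subset)
  then have "card ?M2 \<le> nu H (T - W)"
    by (rule card_le_nu[OF assms(1)])
  moreover have "M = ?M1 \<union> ?M2"
    by blast
  then have "card M \<le> card ?M1 + card ?M2"
    using card_Un_le[of ?M1 ?M2] by simp
  ultimately show ?thesis
    using M(2) by linarith
qed

lemma nu_add_edge:
  assumes "finite_simple_graph H" and "{u, v} \<in> edges H" and "u \<in> T" and "v \<in> T"
  shows "Suc (nu H (T - {u, v})) \<le> nu H T"
proof -
  obtain M where M: "matching (induced_subgraph H (T - {u, v})) M" "card M = nu H (T - {u, v})"
    using maximum_matching[OF assms(1)] .
  have "{u, v} \<notin> M"
    using M(1) by (auto simp: matching_induced)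
  moreover have "disjoint (insert {u, v} M)"
    using M(1) by (auto simp: matching_induced pairwise_insert disjnt_def)
  then have "matching (induced_subgraph H T) (insert {u, v} M)"
    using M(1) assms by (auto simp: matching_induced)
  ultimately show ?thesis
    using card_le_nu[OF assms(1)] finite_matching[OF assms(1) M(1)] M(2)
    by (metis card_insert_disjoint)
qed

lemma nu_remove_isolated:
  assumes "finite_simple_graph H" and "\<And>u. u \<in> T \<Longrightarrow> {u, v} \<notin> edges H"
  shows "nu H (T - {v}) = nu H T"
proof (rule antisym)
  show "nu H (T - {v}) \<le> nu H T"
    by (intro nu_mono assms) auto
  obtain M where M: "matching (induced_subgraph H T) M" "card M = nu H T"
    using maximum_matching[OF assms(1)] .
  have "v \<notin> e" if e: "e \<in> M" for e
  proof
    assume "v \<in> e"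
    moreover have "card e = 2" and eH: "e \<in> edges H" "e \<subseteq> T"
      using e M(1) edge_card[OF assms(1)] by (auto simp: matching_induced)
    ultimately obtain u where "e = {u, v}"
      by (auto simp: card_2_iff)
    then show False
      using assms(2)[of u] eH by simp
  qed
  then have "matching (induced_subgraph H (T - {v})) M"
    using M(1) unfolding matching_induced by blast
  then show "nu H T \<le> nu H (T - {v})"
    using card_le_nu[OF assms(1)] M(2) by metis
qed

text \<open>Removing \<open>u\<close> costs at most one edge and isolates the leaf \<open>v\<close>.\<close>

lemma nu_remove_leaf:
  assumes "finite_simple_graph H" and "{u, v} \<in> edges H" and "u \<in> T" and "v \<in> T"
    and "\<And>w. w \<in> T \<Longrightarrow> {w, v} \<in> edges H \<Longrightarrow> w = u"
  shows "nu H T = Suc (nu H (T - {u, v}))"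
proof (rule antisym)
  show "Suc (nu H (T - {u, v})) \<le> nu H T"
    by (rule nu_add_edge[OF assms(1-4)])
  have "nu H (T - {u} - {v}) = nu H (T - {u})"
    by (rule nu_remove_isolated[OF assms(1)]) (use assms(5) in blast)
  moreover have "T - {u} - {v} = T - {u, v}"
    by auto
  ultimately show "nu H T \<le> Suc (nu H (T - {u, v}))"
    using nu_le_remove[OF assms(1), of "{u}" T] by simp
qed

lemma nu_le_half:
  assumes "finite_simple_graph H" and "finite T"
  shows "2 * nu H T \<le> card T"
proof -
  obtain M where M: "matching (induced_subgraph H T) M" "card M = nu H T"
    using maximum_matching[OF assms(1)] .
  have e: "card e = 2" if "e \<in> M" for e
    using that M(1) edge_card[OF assms(1)] by (auto simp: matching_induced)
  have "card (\<Union>M) = (\<Sum>e\<in>M. card e)"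
    using M(1) e by (intro card_Union_disjoint) (auto simp: matching_induced intro: card_ge_0_finite)
  also have "\<dots> = 2 * card M"
    using e by simp
  finally have "card (\<Union>M) = 2 * nu H T"
    using M(2) by simp
  moreover have "\<Union>M \<subseteq> T"
    using M(1) by (auto simp: matching_induced)
  ultimately show ?thesis
    using card_mono[OF assms(2)] by metis
qed

lemma MF_iff:
  assumes "finite_simple_graph G"
  shows "F \<in> MF q G \<longleftrightarrow> F \<subseteq> verts G \<and> nu G F < q"
proof -
  have "(\<exists>M. matching (induced_subgraph G F) M \<and> card M = q) \<longleftrightarrow> q \<le> nu G F"
  proof
    assume "\<exists>M. matching (induced_subgraph G F) M \<and> card M = q"
    then show "q \<le> nu G F"
      using card_le_nu[OF assms] by blast
  next
    assume le: "q \<le> nu G F"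
    obtain M where M: "matching (induced_subgraph G F) M" "card M = nu G F"
      using maximum_matching[OF assms] .
    then obtain M' where M': "M' \<subseteq> M" "card M' = q"
      using le obtain_subset_with_card_n[of q M] by metis
    then have "matching (induced_subgraph G F) M'"
      using M(1) unfolding matching_induced by (meson pairwise_subset subset_eq)
    then show "\<exists>M. matching (induced_subgraph G F) M \<and> card M = q"
      using M'(2) by blast
  qed
  then show ?thesis
    unfolding MF_def by auto
qed


section \<open>Cycles, forests and bipartite graphs\<close>

text \<open>Every other edge of the path, from its first one on, can be used.\<close>

lemma path_matching:
  assumes "finite_simple_graph H"
  shows "distinct p \<Longrightarrow> (\<And>i. Suc i < length p \<Longrightarrow> {p ! i, p ! Suc i} \<in> edges H) \<Longrightarrow> set p \<subseteq> T \<Longrightarrow>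
    length p div 2 \<le> nu H T"
proof (induction p arbitrary: T rule: induct_list012)
  case (3 x y p)
  have "length p div 2 \<le> nu H (T - {x, y})"
  proof (rule "3.IH"(1))
    show "distinct p" and "set p \<subseteq> T - {x, y}"
      using "3.prems" by auto
    show "{p ! i, p ! Suc i} \<in> edges H" if "Suc i < length p" for i
      using "3.prems"(2)[of "Suc (Suc i)"] that by simp
  qed
  moreover have "{x, y} \<in> edges H"
    using "3.prems"(2)[of 0] by simp
  ultimately show ?case
    using nu_add_edge[OF assms, of x y T] "3.prems"(3) by simp
qed auto

lemma cycle_edge: "cycle H p \<Longrightarrow> Suc i < length p \<Longrightarrow> {p ! i, p ! Suc i} \<in> edges H"
  unfolding cycle_def by (metis Suc_lessD mod_less)

lemma cycle_matching:
  assumes "finite_simple_graph H" and "cycle H p" and "set p \<subseteq> T"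
  shows "length p div 2 \<le> nu H T"
  using assms cycle_edge by (intro path_matching) (auto simp: cycle_def)

lemma cycle_rotate:
  assumes "cycle H p"
  shows "cycle H (rotate k p)"
  unfolding cycle_def
proof (intro conjI allI impI)
  let ?n = "length p"
  have n: "3 \<le> ?n"
    using assms by (simp add: cycle_def)
  show "3 \<le> length (rotate k p)" "distinct (rotate k p)"
    using assms by (auto simp: cycle_def)
  fix i assume "i < length (rotate k p)"
  then have i: "i < ?n"
    by simp
  let ?j = "(k + i) mod ?n"
  have "{p ! ?j, p ! (Suc ?j mod ?n)} \<in> edges H"
    using assms n unfolding cycle_def by (meson less_le_trans mod_less_divisor zero_less_numeral)
  moreover have "Suc ?j mod ?n = (k + Suc i mod ?n) mod ?n"
    by (simp add: mod_simps)
  moreover have "Suc i mod ?n < ?n"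
    using n by (intro mod_less_divisor) linarith
  ultimately show "{rotate k p ! i, rotate k p ! (Suc i mod length (rotate k p))} \<in> edges H"
    using i by (simp add: nth_rotate)
qed

text \<open>A cycle without one of its vertices is a path, seen by rotating the list until it starts at
  that vertex.\<close>

lemma cycle_remove_vertex_matching:
  assumes "finite_simple_graph H" and "cycle H p" and "set p \<subseteq> T"
  shows "(length p - 1) div 2 \<le> nu H (T - {a})"
proof (cases "a \<in> set p")
  case False
  then have "length p div 2 \<le> nu H (T - {a})"
    using assms by (intro cycle_matching) auto
  then show ?thesis
    by linarith
next
  case True
  then obtain k where k: "k < length p" "p ! k = a"
    by (auto simp: in_set_conv_nth)
  let ?r = "rotate k p"
  have cyc: "cycle H ?r"
    using cycle_rotate[OF assms(2)] .
  have "?r ! 0 = a" and "?r \<noteq> []"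
    using k nth_rotate[of 0 p k] by (cases p; simp)+
  then have r: "?r = a # tl ?r"
    by (metis hd_conv_nth list.collapse)
  have "length (tl ?r) div 2 \<le> nu H (T - {a})"
  proof (rule path_matching[OF assms(1)])
    have "distinct (a # tl ?r)"
      using cyc r by (simp add: cycle_def)
    moreover have "set (a # tl ?r) = set p"
      using r by (metis set_rotate)
    ultimately show "distinct (tl ?r)" "set (tl ?r) \<subseteq> T - {a}"
      using assms(3) by auto
    show "{tl ?r ! i, tl ?r ! Suc i} \<in> edges H" if "Suc i < length (tl ?r)" for i
      using cycle_edge[OF cyc, of "Suc i"] that by (simp add: nth_tl)
  qed
  then show ?thesis
    by simp
qed

text \<open>Absence of cycles, phrased through vertices of degree at most one because an induction on
  leaves uses it in this form.\<close>

definition forest_on :: "'a ugraph \<Rightarrow> 'a set \<Rightarrow> bool" where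
  "forest_on H X \<longleftrightarrow> (\<forall>Z\<subseteq>X. Z \<noteq> {} \<longrightarrow> (\<exists>v\<in>Z. card {u \<in> Z. {u, v} \<in> edges H} \<le> 1))"

lemma forest_on_subset: "forest_on H X \<Longrightarrow> Y \<subseteq> X \<Longrightarrow> forest_on H Y"
  unfolding forest_on_def by (meson subset_trans)

text \<open>In a subgraph of minimum degree two, the first vertex of a longest path has all its neighbours
  on the path, and one of them is not the next vertex; the path up to this neighbour closes to a
  cycle.\<close>

lemma cycle_if_not_forest:
  assumes "finite_simple_graph H" and "finite X" and "\<not> forest_on H X"
  obtains p where "cycle H p" and "set p \<subseteq> X"
proof -
  obtain Z where Z: "Z \<subseteq> X" "Z \<noteq> {}"
    and not_le: "\<forall>v\<in>Z. \<not> card {u \<in> Z. {u, v} \<in> edges H} \<le> 1"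
    using assms(3) unfolding forest_on_def by blast
  have deg: "2 \<le> card {u \<in> Z. {u, v} \<in> edges H}" if "v \<in> Z" for v
    using bspec[OF not_le that] by linarith
  have fin: "finite Z"
    using Z(1) assms(2) by (rule finite_subset)
  define path where "path p \<longleftrightarrow> p \<noteq> [] \<and> distinct p \<and> set p \<subseteq> Z \<and>
    (\<forall>i. Suc i < length p \<longrightarrow> {p ! i, p ! Suc i} \<in> edges H)" for p
  obtain z where "z \<in> Z"
    using Z(2) by blast
  then have "path [z]"
    by (simp add: path_def)
  moreover have "\<forall>p. path p \<longrightarrow> length p < Suc (card Z)"
    using fin by (metis card_mono distinct_card le_imp_less_Suc path_def)
  ultimately obtain p where p: "path p" and max: "\<And>p'. path p' \<Longrightarrow> length p' \<le> length p"
    using ex_has_greatest_nat[of path "[z]" length] by blast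
  let ?N = "{u \<in> Z. {u, p ! 0} \<in> edges H}"
  have p0: "p ! 0 \<in> Z"
    using p by (auto simp: path_def)
  \<comment> \<open>\<open>p ! 1\<close> is an arbitrary value if the path has one vertex only; excluding it is harmless then.\<close>
  have "\<not> ?N \<subseteq> {p ! 1}"
    using deg[OF p0] card_mono[of "{p ! 1}" ?N] by auto
  then obtain u where u: "u \<in> Z" "{u, p ! 0} \<in> edges H" "u \<noteq> p ! 1"
    by blast
  have "u \<in> set p"
  proof (rule ccontr)
    assume "u \<notin> set p"
    have "path (u # p)"
      unfolding path_def
    proof (intro conjI allI impI)
      fix i assume "Suc i < length (u # p)"
      then show "{(u # p) ! i, (u # p) ! Suc i} \<in> edges H"
        using p u(2) by (cases i) (auto simp: path_def)
    qed (use p u \<open>u \<notin> set p\<close> in \<open>auto simp: path_def\<close>)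
    then show False
      using max[of "u # p"] by simp
  qed
  then obtain j where j: "j < length p" "p ! j = u"
    by (auto simp: in_set_conv_nth)
  have "j \<noteq> 0"
    using j u(2) edge_neq[OF assms(1)] by metis
  moreover have "j \<noteq> 1"
    using j(2) u(3) by blast
  ultimately have j2: "2 \<le> j"
    by simp
  have "cycle H (take (Suc j) p)"
    unfolding cycle_def
  proof (intro conjI allI impI)
    have len: "length (take (Suc j) p) = Suc j"
      using j(1) by simp
    show "3 \<le> length (take (Suc j) p)"
      using len j2 by simp
    show "distinct (take (Suc j) p)"
      using p by (simp add: path_def)
    fix i assume "i < length (take (Suc j) p)"
    then consider "i < j" | "i = j"
      using len by linarith
    then show "{take (Suc j) p ! i, take (Suc j) p ! (Suc i mod length (take (Suc j) p))} \<in> edges H"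
    proof cases
      case 1
      then show ?thesis
        using p j(1) len by (simp add: path_def)
    next
      case 2
      then show ?thesis
        using u(2) j len by simp
    qed
  qed
  moreover have "set (take (Suc j) p) \<subseteq> X"
    using p Z(1) set_take_subset[of "Suc j" p] unfolding path_def by blast
  ultimately show ?thesis
    using that by blast
qed

definition adjacency :: "'a ugraph \<Rightarrow> 'a rel" where
  "adjacency H = {(u, v). {u, v} \<in> edges H}"

lemma adjacency_relpow_sym: "(u, v) \<in> adjacency H ^^ k \<Longrightarrow> (v, u) \<in> adjacency H ^^ k"
proof (induction k arbitrary: v)
  case (Suc k)
  then obtain w where "(u, w) \<in> adjacency H ^^ k" "(w, v) \<in> adjacency H"
    by auto
  then show ?case
    using Suc.IH by (intro relpow_Suc_I2[of v w]) (auto simp: adjacency_def insert_commute)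
qed simp

text \<open>A repeated vertex cuts an odd closed walk into two shorter closed walks, one of which is odd.
  A shortest odd closed walk is therefore a cycle.\<close>

lemma odd_cycle_if_odd_closed_walk:
  assumes "finite_simple_graph H"
  shows "(v, v) \<in> adjacency H ^^ k \<Longrightarrow> odd k \<Longrightarrow> \<exists>p. cycle H p \<and> odd (length p)"
proof (induction k arbitrary: v rule: less_induct)
  case (less k)
  obtain f where f: "f 0 = v" "f k = v" and step: "\<And>i. i < k \<Longrightarrow> (f i, f (Suc i)) \<in> adjacency H"
    using less.prems(1) unfolding relpow_fun_conv by blast
  show ?case
  proof (cases "inj_on f {0..<k}")
    case True
    have "k \<noteq> 1"
    proof
      assume "k = 1"
      then have "{v, v} \<in> edges H"
        using step[of 0] f by (simp add: adjacency_def)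
      then show False
        using edge_neq[OF assms] by blast
    qed
    then have k3: "3 \<le> k"
      using less.prems(2) by (cases k rule: nat.exhaust) (auto elim!: oddE)
    have "cycle H (map f [0..<k])"
      unfolding cycle_def
    proof (intro conjI allI impI)
      show "3 \<le> length (map f [0..<k])" "distinct (map f [0..<k])"
        using k3 True by (simp_all add: distinct_map)
      fix i assume "i < length (map f [0..<k])"
      then have i: "i < k"
        by simp
      have "f (Suc i mod k) = f (Suc i)"
        using i f by (cases "Suc i = k") auto
      moreover have "Suc i mod k < k"
        using i by simp
      ultimately show "{map f [0..<k] ! i, map f [0..<k] ! (Suc i mod length (map f [0..<k]))} \<in> edges H"
        using step[OF i] i by (simp add: adjacency_def)
    qed
    then show ?thesis
      using less.prems(2) by (intro exI[of _ "map f [0..<k]"]) simp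
  next
    case False
    then obtain i j where ij: "i < j" "j < k" "f i = f j"
      unfolding inj_on_def by (metis atLeastLessThan_iff linorder_neqE_nat)
    have seg: "(f a, f b) \<in> adjacency H ^^ (b - a)" if "a \<le> b" "b \<le> k" for a b
      unfolding relpow_fun_conv using that step by (intro exI[of _ "\<lambda>t. f (a + t)"]) auto
    have inner: "(f i, f i) \<in> adjacency H ^^ (j - i)"
      using seg[of i j] ij by simp
    have outer: "(v, v) \<in> adjacency H ^^ (i + (k - j))"
      using relpow_trans[of "f 0" "f i" i "adjacency H" "f k" "k - j"] seg[of 0 i] seg[of j k] ij f
      by simp
    show ?thesis
    proof (cases "odd (j - i)")
      case True
      then show ?thesis
        using less.IH[OF _ inner] ij by simp
    next
      case False
      moreover have "(j - i) + (i + (k - j)) = k"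
        using ij by simp
      ultimately have "odd (i + (k - j))"
        using less.prems(2) by (metis odd_add)
      then show ?thesis
        using less.IH[OF _ outer] ij by simp
    qed
  qed
qed

text \<open>Fix a root in every component and colour a vertex by the parity of a walk from its root.
  Without odd closed walks the parity does not depend on the walk, and adjacent vertices get
  different colours.\<close>

lemma odd_cycle_if_not_bipartite:
  assumes "finite_simple_graph H" and "\<not> bipartite H"
  obtains p where "cycle H p" and "odd (length p)"
proof (rule ccontr)
  assume "\<not> thesis"
  then have "\<nexists>p. cycle H p \<and> odd (length p)"
    using that by blast
  then have no_walk: "even k" if "(v, v) \<in> adjacency H ^^ k" for v k
    using odd_cycle_if_odd_closed_walk[OF assms(1) that] by blast
  let ?R = "adjacency H"
  define root where "root v = (SOME r. (r, v) \<in> ?R\<^sup>*)" for v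
  have root: "(root v, v) \<in> ?R\<^sup>*" for v
    unfolding root_def by (rule someI[of _ v]) simp
  define A where "A = {v \<in> verts H. \<exists>k. even k \<and> (root v, v) \<in> ?R ^^ k}"
  have colours: "x \<in> A \<longleftrightarrow> y \<notin> A" if xy: "{x, y} \<in> edges H" for x y
  proof -
    have xyR: "(x, y) \<in> ?R" "(y, x) \<in> ?R"
      using xy by (auto simp: adjacency_def insert_commute)
    have xyV: "x \<in> verts H" "y \<in> verts H"
      using edge_subset[OF assms(1) xy] by auto
    have "(r, x) \<in> ?R\<^sup>* \<longleftrightarrow> (r, y) \<in> ?R\<^sup>*" for r
      using xyR by (meson rtrancl.rtrancl_into_rtrancl)
    then have root_eq: "root x = root y"
      by (simp add: root_def)
    have "\<not> (x \<in> A \<and> y \<in> A)"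
    proof
      assume both: "x \<in> A \<and> y \<in> A"
      obtain k where k: "even k" "(root y, x) \<in> ?R ^^ k"
        using both root_eq by (auto simp: A_def)
      obtain l where l: "even l" "(root y, y) \<in> ?R ^^ l"
        using both by (auto simp: A_def)
      have "(root y, root y) \<in> ?R ^^ (Suc k + l)"
        using relpow_trans[OF relpow_Suc_I[OF k(2) xyR(1)] adjacency_relpow_sym[OF l(2)]] .
      then show False
        using no_walk k(1) l(1) by fastforce
    qed
    moreover have "x \<in> A \<or> y \<in> A"
    proof (rule ccontr)
      assume contra: "\<not> (x \<in> A \<or> y \<in> A)"
      obtain k where k: "(root x, x) \<in> ?R ^^ k"
        using root[of x] rtrancl_imp_relpow by metis
      then have "odd k"
        using contra xyV by (auto simp: A_def)
      moreover have "(root y, y) \<in> ?R ^^ Suc k"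
        using relpow_Suc_I[OF k xyR(1)] root_eq by simp
      ultimately show False
        using contra xyV by (auto simp: A_def simp del: relpow.simps)
    qed
    ultimately show ?thesis
      by blast
  qed
  have "bipartite H"
    unfolding bipartite_def
  proof (rule exI[of _ A], rule exI[of _ "verts H - A"], intro conjI ballI)
    show "A \<union> (verts H - A) = verts H" "A \<inter> (verts H - A) = {}"
      by (auto simp: A_def)
    fix e assume e: "e \<in> edges H"
    then obtain x y where xy: "e = {x, y}"
      using edge_card[OF assms(1)] by (metis card_2_iff)
    then have V: "x \<in> verts H" "y \<in> verts H"
      using edge_subset[OF assms(1) e] by auto
    show "\<exists>a\<in>A. \<exists>b\<in>verts H - A. e = {a, b}"
      using colours[of x y] e xy V by (cases "x \<in> A") (auto simp: insert_commute)
  qed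
  then show False
    using assms(2) by contradiction
qed

lemma finite_simple_induced:
  assumes "finite_simple_graph H" and "T \<subseteq> verts H"
  shows "finite_simple_graph (induced_subgraph H T)"
  using assms finite_subset[OF assms(2)] by (auto simp: finite_simple_graph_def induced_subgraph_def)

lemma cycle_induced: "cycle (induced_subgraph H T) p \<longleftrightarrow> cycle H p \<and> set p \<subseteq> T"
proof
  assume p: "cycle (induced_subgraph H T) p"
  have "x \<in> T" if x: "x \<in> set p" for x
  proof -
    obtain i where "i < length p" "x = p ! i"
      using x by (metis in_set_conv_nth)
    then have "{x, p ! (Suc i mod length p)} \<in> edges (induced_subgraph H T)"
      using p unfolding cycle_def by blast
    then show ?thesis
      by (simp add: induced_subgraph_def)
  qed
  then show "cycle H p \<and> set p \<subseteq> T"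
    using p by (auto simp: cycle_def induced_subgraph_def)
next
  assume p: "cycle H p \<and> set p \<subseteq> T"
  then have "0 < length p"
    by (auto simp: cycle_def)
  then have "Suc i mod length p < length p" for i
    by simp
  then show "cycle (induced_subgraph H T) p"
    using p by (auto simp: cycle_def induced_subgraph_def)
qed

lemma bipartite_induced:
  assumes "bipartite H" and "T \<subseteq> verts H"
  shows "bipartite (induced_subgraph H T)"
proof -
  obtain A B where AB: "A \<union> B = verts H" "A \<inter> B = {}" "\<forall>e\<in>edges H. \<exists>a\<in>A. \<exists>b\<in>B. e = {a, b}"
    using assms(1) unfolding bipartite_def by blast
  show ?thesis
    unfolding bipartite_def
  proof (rule exI[of _ "A \<inter> T"], rule exI[of _ "B \<inter> T"], intro conjI ballI)
    show "A \<inter> T \<union> B \<inter> T = verts (induced_subgraph H T)" "A \<inter> T \<inter> (B \<inter> T) = {}"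
      using AB(1,2) assms(2) by (auto simp: induced_subgraph_def)
    fix e assume "e \<in> edges (induced_subgraph H T)"
    then have e: "e \<in> edges H" "e \<subseteq> T"
      by (auto simp: induced_subgraph_def)
    then obtain a b where ab: "a \<in> A" "b \<in> B" "e = {a, b}"
      using AB(3) by metis
    then have "a \<in> T" "b \<in> T"
      using e(2) by auto
    then show "\<exists>a\<in>A \<inter> T. \<exists>b\<in>B \<inter> T. e = {a, b}"
      using ab by (metis IntI)
  qed
qed

text \<open>The core of Koenig's theorem: some end of an edge \<open>{u, v}\<close> lies in all maximum
  matchings.
  Otherwise let the maximum matching \<open>M\<close> miss \<open>u\<close> and let the maximum
  matching \<open>N\<close> miss \<open>v\<close>. From \<open>u\<close> walk along edges of
  \<open>N\<close> out of the side \<open>P\<close> of \<open>u\<close> and along edges of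
  \<open>M\<close> out of the other side \<open>Q\<close>. The set \<open>Z\<close> of vertices
  reached is a union of components of \<open>M \<union> N\<close>, and it does not contain
  \<open>v\<close>, because a vertex of \<open>Q\<close> is only reached along an edge of
  \<open>N\<close>. Exchanging \<open>M\<close> and \<open>N\<close> on \<open>Z\<close> gives
  matchings that are again maximum, and the one that agrees with \<open>N\<close> outside
  \<open>Z\<close> misses both \<open>u\<close> and \<open>v\<close>, so the edge can be added
  to it.\<close>

lemma bipartite_essential_vertex:
  assumes "finite_simple_graph H" and "bipartite (induced_subgraph H T)"
    and "e0 \<in> edges H" and "e0 \<subseteq> T"
  shows "\<exists>w\<in>T. nu H (T - {w}) < nu H T"
proof (rule ccontr)
  assume "\<not> ?thesis"
  then have inessential: "nu H (T - {w}) = nu H T" if "w \<in> T" for w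
    using that nu_mono[OF assms(1), of "T - {w}" T] by force
  obtain P Q where PQ: "P \<union> Q = T" "P \<inter> Q = {}"
    and bip: "\<And>e. e \<in> edges H \<Longrightarrow> e \<subseteq> T \<Longrightarrow> \<exists>a\<in>P. \<exists>b\<in>Q. e = {a, b}"
    using assms(2) unfolding bipartite_def induced_subgraph_def by auto
  obtain u v where uv: "u \<in> P" "v \<in> Q" "e0 = {u, v}"
    using bip[OF assms(3,4)] by blast
  obtain M where M: "matching (induced_subgraph H (T - {u})) M" "card M = nu H T"
    using maximum_matching[OF assms(1), of "T - {u}"] inessential[of u] uv PQ by (metis UnI1)
  obtain N where N: "matching (induced_subgraph H (T - {v})) N" "card N = nu H T"
    using maximum_matching[OF assms(1), of "T - {v}"] inessential[of v] uv PQ by (metis UnI2)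
  have MT: "e \<in> edges H" "e \<subseteq> T" "u \<notin> e" if "e \<in> M" for e
    using M(1) that by (auto simp: matching_induced)
  have NT: "e \<in> edges H" "e \<subseteq> T" "v \<notin> e" if "e \<in> N" for e
    using N(1) that by (auto simp: matching_induced)
  have dM: "disjoint M" and dN: "disjoint N"
    using M(1) N(1) by (auto simp: matching_induced)
  have across: "a \<in> P \<longleftrightarrow> b \<in> Q" if "{a, b} \<in> M \<union> N" for a b
  proof -
    have "{a, b} \<in> edges H" "{a, b} \<subseteq> T"
      using that MT(1,2) NT(1,2) by (meson UnE)+
    then obtain a' b' where "a' \<in> P" "b' \<in> Q" "{a, b} = {a', b'}"
      using bip by blast
    then show ?thesis
      using PQ(2) by (auto simp: doubleton_eq_iff)
  qed
  \<comment> \<open>One step of the alternating walk; the sides determine which matching is used.\<close>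
  define R where "R = {(p, q). p \<in> P \<and> {p, q} \<in> N} \<union> {(q, p). q \<in> Q \<and> {q, p} \<in> M}"
  define Z where "Z = {z. (u, z) \<in> R\<^sup>*}"
  have uZ: "u \<in> Z"
    by (simp add: Z_def)
  have step: "y \<in> Z" if "x \<in> Z" "(x, y) \<in> R" for x y
    using that unfolding Z_def by (auto intro: rtrancl_into_rtrancl)
  have pred: "\<exists>x\<in>Z. (x, y) \<in> R" if "y \<in> Z" "y \<noteq> u" for y
    using that unfolding Z_def by (metis mem_Collect_eq rtranclE)
  have intoQ: "\<exists>p\<in>Z. {p, q} \<in> N" if "q \<in> Z" "q \<in> Q" for q
  proof -
    have "q \<noteq> u"
      using that uv PQ by blast
    then obtain x where x: "x \<in> Z" "(x, q) \<in> R"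
      using pred \<open>q \<in> Z\<close> by blast
    moreover have "\<not> (x \<in> Q \<and> {x, q} \<in> M)"
      using across[of q x] PQ(2) that(2) by (auto simp: insert_commute)
    ultimately show ?thesis
      unfolding R_def by blast
  qed
  have intoP: "\<exists>q\<in>Z. {q, p} \<in> M" if "p \<in> Z" "p \<in> P" "p \<noteq> u" for p
  proof -
    obtain x where x: "x \<in> Z" "(x, p) \<in> R"
      using pred \<open>p \<in> Z\<close> \<open>p \<noteq> u\<close> by blast
    moreover have "\<not> (x \<in> P \<and> {x, p} \<in> N)"
      using across[of x p] PQ(2) that(2) by auto
    ultimately show ?thesis
      unfolding R_def by blast
  qed
  have vZ: "v \<notin> Z"
    using intoQ[of v] NT(3) uv(2) by blast
  have closedN: "e \<subseteq> Z" if "e \<in> N" "e \<inter> Z \<noteq> {}" for e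
  proof -
    obtain p q where e: "p \<in> P" "q \<in> Q" "e = {p, q}"
      using bip NT(1,2) \<open>e \<in> N\<close> by blast
    have "q \<in> Z" if "p \<in> Z"
      using step[OF that] e \<open>e \<in> N\<close> unfolding R_def by blast
    moreover have "p \<in> Z" if "q \<in> Z"
    proof -
      obtain x where x: "x \<in> Z" "{x, q} \<in> N"
        using intoQ[OF \<open>q \<in> Z\<close> e(2)] by blast
      then have "{x, q} = {p, q}"
        using disjointD[OF dN, of "{x, q}" "{p, q}"] e(3) \<open>e \<in> N\<close> by auto
      then show ?thesis
        using x(1) by (auto simp: doubleton_eq_iff)
    qed
    ultimately show ?thesis
      using e(3) \<open>e \<inter> Z \<noteq> {}\<close> by auto
  qed
  have closedM: "e \<subseteq> Z" if "e \<in> M" "e \<inter> Z \<noteq> {}" for e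
  proof -
    obtain p q where e: "p \<in> P" "q \<in> Q" "e = {p, q}"
      using bip MT(1,2) \<open>e \<in> M\<close> by blast
    have "p \<in> Z" if "q \<in> Z"
      using step[OF that] e \<open>e \<in> M\<close> unfolding R_def by (auto simp: insert_commute)
    moreover have "q \<in> Z" if "p \<in> Z"
    proof -
      have "p \<noteq> u"
        using MT(3)[OF \<open>e \<in> M\<close>] e(3) by blast
      then obtain x where x: "x \<in> Z" "{x, p} \<in> M"
        using intoP[OF \<open>p \<in> Z\<close> e(1)] by blast
      then have "{x, p} = {p, q}"
        using disjointD[OF dM, of "{x, p}" "{p, q}"] e(3) \<open>e \<in> M\<close> by auto
      then show ?thesis
        using x(1) by (auto simp: doubleton_eq_iff)
    qed
    ultimately show ?thesis
      using e(3) \<open>e \<inter> Z \<noteq> {}\<close> by auto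
  qed
  define N1 N2 M1 M2 where "N1 = {e \<in> N. e \<inter> Z = {}}" and "N2 = {e \<in> N. e \<inter> Z \<noteq> {}}"
    and "M1 = {e \<in> M. e \<inter> Z = {}}" and "M2 = {e \<in> M. e \<inter> Z \<noteq> {}}"
  note defs = N1_def N2_def M1_def M2_def
  have fin: "finite M" "finite N"
    using finite_matching[OF assms(1)] M(1) N(1) by blast+
  have cN: "card N = card N1 + card N2"
    unfolding defs using fin by (subst card_Un_disjoint[symmetric]) (auto intro: arg_cong[of _ _ card])
  have cM: "card M = card M1 + card M2"
    unfolding defs using fin by (subst card_Un_disjoint[symmetric]) (auto intro: arg_cong[of _ _ card])
  have swap: "disjoint ({e \<in> A. e \<inter> Z = {}} \<union> {e \<in> B. e \<inter> Z \<noteq> {}})"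
    if A: "disjoint A" and B: "disjoint B" and closed: "\<And>e. e \<in> B \<Longrightarrow> e \<inter> Z \<noteq> {} \<Longrightarrow> e \<subseteq> Z"
    for A B :: "'a set set"
  proof (rule disjointI)
    fix d e
    assume "d \<in> {e \<in> A. e \<inter> Z = {}} \<union> {e \<in> B. e \<inter> Z \<noteq> {}}"
      and "e \<in> {e \<in> A. e \<inter> Z = {}} \<union> {e \<in> B. e \<inter> Z \<noteq> {}}" and "d \<noteq> e"
    then consider "d \<in> A" "e \<in> A" | "d \<in> B" "e \<in> B"
      | "d \<inter> Z = {}" "e \<subseteq> Z" | "d \<subseteq> Z" "e \<inter> Z = {}"
      using closed by auto
    then show "d \<inter> e = {}"
      using disjointD[OF A] disjointD[OF B] \<open>d \<noteq> e\<close> by cases auto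
  qed
  have "disjoint (M1 \<union> N2)" and disjN: "disjoint (N1 \<union> M2)"
    unfolding defs by (intro swap dM dN closedM closedN; assumption)+
  then have "matching (induced_subgraph H T) (M1 \<union> N2)"
    unfolding matching_induced using MT(1,2) NT(1,2) by (intro conjI; (simp add: defs; blast)?)
  then have "card (M1 \<union> N2) \<le> nu H T"
    by (rule card_le_nu[OF assms(1)])
  moreover have "M1 \<inter> N2 = {}" "N1 \<inter> M2 = {}"
    by (auto simp: defs)
  then have "card (M1 \<union> N2) = card M1 + card N2" "card (N1 \<union> M2) = card N1 + card M2"
    using fin by (auto simp: defs intro!: card_Un_disjoint)
  ultimately have "nu H T \<le> card (N1 \<union> M2)"
    using cM cN M(2) N(2) by linarith
  moreover have "u \<notin> e \<and> v \<notin> e" if "e \<in> N1 \<union> M2" for e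
    using that uZ vZ MT(3) NT(3) closedM unfolding defs by blast
  then have "matching (induced_subgraph H (T - {u, v})) (N1 \<union> M2)"
    unfolding matching_induced using MT(1,2) NT(1,2) disjN
    by (intro conjI; (simp add: defs; blast)?)
  then have "card (N1 \<union> M2) \<le> nu H (T - {u, v})"
    by (rule card_le_nu[OF assms(1)])
  moreover have "Suc (nu H (T - {u, v})) \<le> nu H T"
    using nu_add_edge[OF assms(1)] assms(3,4) uv(3) by auto
  ultimately show False
    by linarith
qed


section \<open>Whisker graphs\<close>

definition weight :: "'a ugraph \<Rightarrow> 'a set \<Rightarrow> 'a set \<Rightarrow> nat" where
  "weight H X Y = card (X \<inter> Y) + nu H (X - Y)"

lemma finite_simple_whisker:
  assumes "finite_simple_graph H"
  shows "finite_simple_graph (whisker_graph H)"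
  unfolding finite_simple_graph_def
proof (intro conjI ballI)
  show "finite (verts (whisker_graph H))"
    using finite_verts[OF assms] by (simp add: whisker_graph_def)
  fix e assume "e \<in> edges (whisker_graph H)"
  then consider d where "d \<in> edges H" "e = Inl ` d" | x where "x \<in> verts H" "e = {Inl x, Inr x}"
    by (auto simp: whisker_graph_def)
  then show "e \<subseteq> verts (whisker_graph H)" "card e = 2"
    using edge_card[OF assms] edge_subset[OF assms]
    by (cases; auto simp: whisker_graph_def card_image)+
qed

lemma nu_whisker_no_pendant_edge:
  assumes "finite_simple_graph H" and "Inl -` F \<inter> Inr -` F = {}"
  shows "nu (whisker_graph H) F = nu H (Inl -` F)"
proof (rule antisym)
  let ?G = "whisker_graph H"
  note G = finite_simple_whisker[OF assms(1)]
  have inj: "inj ((`) (Inl :: 'a \<Rightarrow> 'a + 'a))"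
    by (simp add: inj_image_eq_iff inj_def)
  obtain M where M: "matching (induced_subgraph ?G F) M" "card M = nu ?G F"
    using maximum_matching[OF G] .
  define M' where "M' = {d \<in> edges H. Inl ` d \<in> M}"
  have "M = (`) Inl ` M'"
  proof -
    have "\<exists>d\<in>M'. e = Inl ` d" if "e \<in> M" for e
    proof -
      have "e \<in> edges ?G" "e \<subseteq> F"
        using M(1) that by (auto simp: matching_induced)
      moreover have "\<not> {Inl x, Inr x} \<subseteq> F" for x
        using assms(2) by auto
      ultimately obtain d where "d \<in> edges H" "e = Inl ` d"
        by (auto simp: whisker_graph_def)
      then show ?thesis
        using that by (auto simp: M'_def)
    qed
    then have "M \<subseteq> (`) Inl ` M'"
      by blast
    then show ?thesis
      by (auto simp: M'_def)
  qed
  then have "card M = card M'"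
    using inj by (simp add: card_image inj_on_subset[OF inj])
  moreover have "matching (induced_subgraph H (Inl -` F)) M'"
    unfolding matching_induced
  proof (intro conjI ballI disjointI)
    show "M' \<subseteq> edges H"
      by (auto simp: M'_def)
    show "d \<subseteq> Inl -` F" if "d \<in> M'" for d
      using that M(1) unfolding M'_def matching_induced by blast
    fix a b assume ab: "a \<in> M'" "b \<in> M'" "a \<noteq> b"
    then have "Inl ` a \<noteq> (Inl ` b :: ('a + 'a) set)"
      using inj by (simp add: inj_eq)
    then have "Inl ` a \<inter> (Inl ` b :: ('a + 'a) set) = {}"
      using ab M(1) disjointD[of M "Inl ` a" "Inl ` b"] by (auto simp: M'_def matching_induced)
    then show "a \<inter> b = {}"
      by auto
  qed
  ultimately show "nu ?G F \<le> nu H (Inl -` F)"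
    using card_le_nu[OF assms(1)] M(2) by metis
next
  let ?G = "whisker_graph H"
  note G = finite_simple_whisker[OF assms(1)]
  obtain M where M: "matching (induced_subgraph H (Inl -` F)) M" "card M = nu H (Inl -` F)"
    using maximum_matching[OF assms(1)] .
  have "matching (induced_subgraph ?G F) ((`) Inl ` M)"
    unfolding matching_induced
  proof (intro conjI)
    show "(`) Inl ` M \<subseteq> edges ?G"
      using M(1) by (auto simp: matching_induced whisker_graph_def)
    show "\<forall>e\<in>(`) Inl ` M. e \<subseteq> F"
      using M(1) by (auto simp: matching_induced)
    show "disjoint ((`) Inl ` M)"
      using M(1) by (intro disjoint_image) (auto simp: matching_induced)
  qed
  moreover have "card ((`) Inl ` M :: ('a + 'a) set set) = card M"
    by (rule card_image) (simp add: inj_on_def inj_image_eq_iff)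
  ultimately show "nu H (Inl -` F) \<le> nu ?G F"
    using card_le_nu[OF G] M(2) by metis
qed

text \<open>Some maximum matching uses all whiskers whose two ends lie in \<open>F\<close>: these edges
  can be added greedily, and conversely the removal of their ends in \<open>H\<close> costs at
  most one edge each and leaves no whisker.\<close>

lemma nu_whisker:
  assumes "finite_simple_graph H" and "F \<subseteq> verts H <+> verts H"
  shows "nu (whisker_graph H) F = weight H (Inl -` F) (Inr -` F)"
proof -
  let ?G = "whisker_graph H"
  let ?A = "Inl -` F \<inter> Inr -` F"
  note G = finite_simple_whisker[OF assms(1)]
  have AV: "?A \<subseteq> verts H"
    using assms(2) by auto
  have fin: "finite ?A"
    using AV finite_verts[OF assms(1)] by (rule finite_subset)
  have rest: "nu ?G F' = nu H (Inl -` F - Inr -` F)"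
    if "Inl -` F' = Inl -` F - Inr -` F" "Inr -` F' \<subseteq> Inr -` F" for F'
    using that by (subst nu_whisker_no_pendant_edge[OF assms(1)]) auto
  have "card A + nu ?G (F - Inl ` A - Inr ` A) \<le> nu ?G F" if "A \<subseteq> ?A" for A
    using finite_subset[OF that fin] that
  proof (induction A rule: finite_induct)
    case (insert a A)
    let ?F = "F - Inl ` A - Inr ` A"
    have "Suc (nu ?G (?F - {Inl a, Inr a})) \<le> nu ?G ?F"
      using insert AV by (intro nu_add_edge[OF G]) (auto simp: whisker_graph_def)
    moreover have "?F - {Inl a, Inr a} = F - Inl ` insert a A - Inr ` insert a A"
      by auto
    ultimately show ?case
      using insert by simp
  qed simp
  from this[OF order.refl] have "card ?A + nu H (Inl -` F - Inr -` F) \<le> nu ?G F"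
    by (subst (asm) rest) auto
  moreover have "nu ?G F \<le> card (Inl ` ?A :: ('a + 'a) set) + nu ?G (F - Inl ` ?A)"
    using fin by (intro nu_le_remove[OF G]) simp
  then have "nu ?G F \<le> card ?A + nu H (Inl -` F - Inr -` F)"
    by (subst (asm) rest) (auto simp: card_image)
  ultimately show ?thesis
    unfolding weight_def by (rule antisym[rotated])
qed

lemma MF_whisker:
  assumes "finite_simple_graph H"
  shows "F \<in> MF q (whisker_graph H) \<longleftrightarrow>
    F \<subseteq> verts H <+> verts H \<and> weight H (Inl -` F) (Inr -` F) < q"
  unfolding MF_iff[OF finite_simple_whisker[OF assms]] using nu_whisker[OF assms]
  by (auto simp: whisker_graph_def)

lemma matching_number_whisker:
  assumes "finite_simple_graph H"
  shows "matching_number (whisker_graph H) = card (verts H)"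
proof -
  let ?G = "whisker_graph H"
  have "induced_subgraph ?G (verts H <+> verts H) = ?G"
    using edge_subset[OF finite_simple_whisker[OF assms]]
    by (auto simp: induced_subgraph_def whisker_graph_def)
  then have "matching_number ?G = weight H (verts H) (verts H)"
    using nu_whisker[OF assms, of "verts H <+> verts H"] by (simp add: vimage_def Plus_def image_iff)
  moreover have "nu H {} = 0"
    using nu_le_half[OF assms, of "{}"] by simp
  ultimately show ?thesis
    by (simp add: weight_def)
qed


section \<open>The weight function\<close>

text \<open>Moving a vertex of \<open>X\<close> into \<open>Y\<close> adds one to the first summand and
  takes at most one away from the second.\<close>

lemma weight_mono:
  assumes "finite_simple_graph H" and "finite X'" and "X \<subseteq> X'" and "Y \<subseteq> Y'"
  shows "weight H X Y \<le> weight H X' Y'"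
proof -
  let ?W = "X \<inter> (Y' - Y)"
  have fin: "finite X"
    using assms(2,3) finite_subset by blast
  have "X - Y - ?W = X - Y'"
    using assms(4) by blast
  then have "nu H (X - Y) \<le> card ?W + nu H (X - Y')"
    using nu_le_remove[OF assms(1), of ?W "X - Y"] fin by simp
  moreover have "card (X \<inter> Y') = card (X \<inter> Y) + card ?W"
  proof -
    have "X \<inter> Y' = (X \<inter> Y) \<union> ?W" "(X \<inter> Y) \<inter> ?W = {}"
      using assms(4) by blast+
    then show ?thesis
      using fin by (metis card_Un_disjoint finite_Int)
  qed
  moreover have "card (X \<inter> Y') \<le> card (X' \<inter> Y')"
    using assms(2,3) by (intro card_mono) auto
  moreover have "nu H (X - Y') \<le> nu H (X' - Y')"
    using assms(3) by (intro nu_mono[OF assms(1)]) blast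
  ultimately show ?thesis
    unfolding weight_def by linarith
qed

lemma weight_le_card:
  assumes "finite_simple_graph H" and "finite X"
  shows "weight H X Y \<le> card X"
proof -
  have "nu H (X - Y) \<le> card (X - Y)"
    using nu_le_half[OF assms(1), of "X - Y"] assms(2) by simp
  moreover have "card X = card (X \<inter> Y) + card (X - Y)"
    using card_Int_Diff[OF assms(2)] .
  ultimately show ?thesis
    unfolding weight_def by linarith
qed

lemma weight_insert:
  assumes "finite X" and "v \<in> X" and "v \<notin> Y"
  shows "weight H X (insert v Y) = Suc (card (X \<inter> Y) + nu H (X - Y - {v}))"
proof -
  have "X \<inter> insert v Y = insert v (X \<inter> Y)" and "X - insert v Y = X - Y - {v}"
    using assms by blast+
  then show ?thesis
    using assms by (simp add: weight_def)
qed

lemma weight_insert_left: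
  assumes "finite X" and "v \<notin> X" and "v \<in> Y"
  shows "weight H (insert v X) Y = Suc (weight H X Y)"
proof -
  have "insert v X \<inter> Y = insert v (X \<inter> Y)" and "insert v X - Y = X - Y"
    using assms by blast+
  then show ?thesis
    using assms by (simp add: weight_def)
qed

lemma weight_insert_le:
  assumes "finite_simple_graph H" and "finite X"
  shows "weight H (insert v X) Y \<le> Suc (weight H X Y)"
    and "weight H X (insert v Y) \<le> Suc (weight H X Y)"
proof -
  consider "v \<in> X" | "v \<notin> X" "v \<in> Y" | "v \<notin> X" "v \<notin> Y"
    by blast
  then show "weight H (insert v X) Y \<le> Suc (weight H X Y)"
  proof cases
    case 1
    then show ?thesis
      by (simp add: insert_absorb)
  next
    case 2
    then show ?thesis
      using weight_insert_left assms(2) by (metis order.refl)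
  next
    case 3
    then have "insert v X \<inter> Y = X \<inter> Y" and "insert v X - Y - {v} = X - Y"
      by blast+
    then show ?thesis
      using nu_le_remove[OF assms(1), of "{v}" "insert v X - Y"] by (simp add: weight_def)
  qed
  have "nu H (X - insert v Y) \<le> nu H (X - Y)"
    by (intro nu_mono[OF assms(1)]) blast
  moreover have "card (X \<inter> insert v Y) \<le> card (insert v (X \<inter> Y))"
    using assms(2) by (intro card_mono) auto
  moreover have "card (insert v (X \<inter> Y)) \<le> Suc (card (X \<inter> Y))"
    using assms(2) by (simp add: card_insert_if)
  ultimately show "weight H X (insert v Y) \<le> Suc (weight H X Y)"
    unfolding weight_def by linarith
qed

text \<open>Any hereditary condition \<open>P\<close> on the vertices of \<open>H\<close> in a face cuts
  out a subcomplex; it will be acyclicity or no condition.\<close>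

lemma complex_MF:
  assumes "finite_simple_graph H"
    and "\<And>X X'. P X' \<Longrightarrow> X \<subseteq> X' \<Longrightarrow> P X"
  shows "simplicial_complex {F \<in> MF q (whisker_graph H). P (Inl -` F)}"
  unfolding simplicial_complex_def
proof (intro ballI conjI allI impI)
  let ?V = "verts H"
  fix F assume F: "F \<in> {F \<in> MF q (whisker_graph H). P (Inl -` F)}"
  then have FV: "F \<subseteq> ?V <+> ?V" and w: "weight H (Inl -` F) (Inr -` F) < q" and P: "P (Inl -` F)"
    using MF_whisker[OF assms(1)] by auto
  show "finite F"
    using FV finite_verts[OF assms(1)] by (meson finite_Plus finite_subset)
  fix F' assume sub: "F' \<subseteq> F"
  have "finite (Inl -` F)"
    using \<open>finite F\<close> by (simp add: finite_vimageI)
  then have "weight H (Inl -` F') (Inr -` F') \<le> weight H (Inl -` F) (Inr -` F)"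
    using sub by (intro weight_mono[OF assms(1)]) auto
  then have "F' \<in> MF q (whisker_graph H)"
    unfolding MF_whisker[OF assms(1)] using sub FV w by (meson le_less_trans order_trans)
  moreover have "P (Inl -` F')"
    using assms(2)[OF P] sub by blast
  ultimately show "F' \<in> {F \<in> MF q (whisker_graph H). P (Inl -` F)}"
    by simp
qed

lemma finite_MF:
  assumes "finite_simple_graph H"
  shows "finite (MF q (whisker_graph H))"
proof -
  have "MF q (whisker_graph H) \<subseteq> Pow (verts H <+> verts H)"
    using MF_whisker[OF assms] by blast
  then show ?thesis
    using finite_verts[OF assms] by (meson finite_Plus finite_Pow_iff finite_subset)
qed

lemma card_sum_set:
  assumes "finite F"
  shows "card F = card (Inl -` F) + card (Inr -` F)"
proof -
  have "F = Inl -` F <+> Inr -` F"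
  proof (rule set_eqI)
    fix z
    show "z \<in> F \<longleftrightarrow> z \<in> Inl -` F <+> Inr -` F"
      by (cases z) auto
  qed
  moreover have "finite (Inl -` F)" "finite (Inr -` F)"
    using assms by (simp_all add: finite_vimageI)
  ultimately show ?thesis
    using card_Plus by metis
qed

lemma face_card:
  assumes "finite_simple_graph H" and "F \<subseteq> verts H <+> verts H"
  shows "card F = card (Inl -` F \<union> Inr -` F) + card (Inl -` F \<inter> Inr -` F)"
proof -
  have "finite F"
    using assms finite_verts by (meson finite_Plus finite_subset)
  then show ?thesis
    using card_sum_set[of F] card_Un_Int[of "Inl -` F" "Inr -` F"] by (simp add: finite_vimageI)
qed


section \<open>The complexes on the pendant vertices\<close>

text \<open>What remains of the faces once their part in \<open>H\<close> is fixed to be \<open>T\<close>: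
  the pendant vertices at \<open>T\<close> are restricted by the weight, and those at
  \<open>Z\<close> are free.\<close>

definition pendant_complex :: "'a ugraph \<Rightarrow> 'a set \<Rightarrow> 'a set \<Rightarrow> nat \<Rightarrow> ('a + 'a) set set" where
  "pendant_complex H T Z p = {F. F \<subseteq> Inr ` (T \<union> Z) \<and> weight H T (Inr -` F) < p}"

lemma complex_pendant:
  assumes "finite_simple_graph H" and "finite T" and "finite Z"
  shows "simplicial_complex (pendant_complex H T Z p)"
  unfolding simplicial_complex_def
proof (intro ballI conjI allI impI)
  fix F assume F: "F \<in> pendant_complex H T Z p"
  then show "finite F"
    using assms unfolding pendant_complex_def by (auto intro: finite_subset)
  fix F' assume "F' \<subseteq> F"
  moreover from this have "weight H T (Inr -` F') \<le> weight H T (Inr -` F)"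
    by (intro weight_mono[OF assms(1,2)]) auto
  ultimately show "F' \<in> pendant_complex H T Z p"
    using F unfolding pendant_complex_def by auto
qed

lemma link_pendant:
  assumes "finite_simple_graph H" and "finite T" and "finite Z" and "v \<in> T" and "T \<inter> Z = {}"
    and "0 < p"
  shows "link (pendant_complex H T Z p) {Inr v} = pendant_complex H (T - {v}) Z (p - 1)"
proof (rule set_eqI)
  fix F :: "('a + 'a) set"
  let ?Y = "Inr -` F"
  note cx = complex_pendant[OF assms(1-3), of p]
  have "F \<in> link (pendant_complex H T Z p) {Inr v} \<longleftrightarrow>
      Inr v \<notin> F \<and> insert (Inr v) F \<in> pendant_complex H T Z p"
    using complexD(2)[OF cx, of "insert (Inr v) F" F] by (auto simp: link_def)
  also have "\<dots> \<longleftrightarrow> F \<subseteq> Inr ` ((T - {v}) \<union> Z) \<and> weight H T (insert v ?Y) < p"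
  proof -
    have "Inr -` insert (Inr v) F = insert v ?Y"
      by auto
    moreover have "Inr v \<notin> F \<and> insert (Inr v) F \<subseteq> Inr ` (T \<union> Z) \<longleftrightarrow> F \<subseteq> Inr ` ((T - {v}) \<union> Z)"
      using assms(4,5) by auto
    ultimately show ?thesis
      unfolding pendant_complex_def by auto
  qed
  also have "\<dots> \<longleftrightarrow> F \<in> pendant_complex H (T - {v}) Z (p - 1)"
  proof -
    have "weight H T (insert v ?Y) = Suc (weight H (T - {v}) ?Y)" if "F \<subseteq> Inr ` ((T - {v}) \<union> Z)"
    proof -
      have "v \<notin> ?Y"
        using that assms(4,5) by auto
      moreover from this have "T \<inter> ?Y = (T - {v}) \<inter> ?Y" "T - ?Y - {v} = T - {v} - ?Y"
        by auto
      ultimately show ?thesis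
        using weight_insert[OF assms(2,4)] by (simp add: weight_def)
    qed
    then show ?thesis
      using assms(6) unfolding pendant_complex_def by auto
  qed
  finally show "F \<in> link (pendant_complex H T Z p) {Inr v} \<longleftrightarrow>
    F \<in> pendant_complex H (T - {v}) Z (p - 1)" .
qed

lemma deletion_pendant_isolated:
  assumes "finite_simple_graph H" and "v \<in> T" and "T \<inter> Z = {}"
    and "\<And>u. u \<in> T \<Longrightarrow> {u, v} \<notin> edges H"
  shows "deletion (pendant_complex H T Z p) (Inr v) = pendant_complex H (T - {v}) Z p"
proof (rule set_eqI)
  fix F :: "('a + 'a) set"
  let ?Y = "Inr -` F"
  have "F \<in> deletion (pendant_complex H T Z p) (Inr v) \<longleftrightarrow>
      F \<subseteq> Inr ` ((T - {v}) \<union> Z) \<and> weight H T ?Y < p"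
    using assms(2,3) by (auto simp: deletion_def pendant_complex_def)
  moreover have "weight H T ?Y = weight H (T - {v}) ?Y" if "F \<subseteq> Inr ` ((T - {v}) \<union> Z)"
  proof -
    have "v \<notin> ?Y"
      using that assms(2,3) by auto
    then have "T \<inter> ?Y = (T - {v}) \<inter> ?Y" "T - ?Y - {v} = T - {v} - ?Y"
      by auto
    moreover have "nu H (T - ?Y - {v}) = nu H (T - ?Y)"
      by (rule nu_remove_isolated[OF assms(1)]) (use assms(4) in blast)
    ultimately show ?thesis
      by (simp add: weight_def)
  qed
  ultimately show "F \<in> deletion (pendant_complex H T Z p) (Inr v) \<longleftrightarrow>
      F \<in> pendant_complex H (T - {v}) Z p"
    unfolding pendant_complex_def by auto
qed

text \<open>If the leaf \<open>v\<close> stays out of the face, then its edge to \<open>u\<close>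
  contributes one to the weight in any case: as an element of the intersection if
  \<open>u\<close> is chosen, and as a matching edge otherwise. Hence \<open>u\<close> becomes
  free.\<close>

lemma deletion_pendant_leaf:
  assumes "finite_simple_graph H" and "finite T" and "v \<in> T" and "u \<in> T" and "T \<inter> Z = {}"
    and "{u, v} \<in> edges H" and "\<And>w. w \<in> T \<Longrightarrow> {w, v} \<in> edges H \<Longrightarrow> w = u"
    and "0 < p"
  shows "deletion (pendant_complex H T Z p) (Inr v) =
    pendant_complex H (T - {u, v}) (insert u Z) (p - 1)"
proof (rule set_eqI)
  fix F :: "('a + 'a) set"
  let ?Y = "Inr -` F"
  have uv: "u \<noteq> v"
    using edge_neq[OF assms(1,6)] .
  have eq: "(T - {u, v}) \<union> insert u Z = (T \<union> Z) - {v}"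
    using assms(3-5) uv by blast
  have "F \<in> deletion (pendant_complex H T Z p) (Inr v) \<longleftrightarrow>
      F \<subseteq> Inr ` ((T \<union> Z) - {v}) \<and> weight H T ?Y < p"
    by (auto simp: deletion_def pendant_complex_def)
  moreover have "weight H T ?Y = Suc (weight H (T - {u, v}) ?Y)" if "F \<subseteq> Inr ` ((T \<union> Z) - {v})"
  proof -
    have v: "v \<notin> ?Y"
      using that by auto
    show ?thesis
    proof (cases "u \<in> ?Y")
      case True
      then have "T \<inter> ?Y = insert u ((T - {u, v}) \<inter> ?Y)" "T - ?Y - {v} = T - {u, v} - ?Y"
        using v assms(4) by blast+
      moreover have "nu H (T - ?Y - {v}) = nu H (T - ?Y)"
        by (rule nu_remove_isolated[OF assms(1)]) (use True assms(7) in blast)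
      ultimately show ?thesis
        using assms(2) by (simp add: weight_def)
    next
      case False
      then have "T \<inter> ?Y = (T - {u, v}) \<inter> ?Y" "T - ?Y - {u, v} = T - {u, v} - ?Y"
        using v by blast+
      moreover have "nu H (T - ?Y) = Suc (nu H (T - ?Y - {u, v}))"
        using False v assms(3,4,7) by (intro nu_remove_leaf[OF assms(1,6)]) blast+
      ultimately show ?thesis
        by (simp add: weight_def)
    qed
  qed
  ultimately show "F \<in> deletion (pendant_complex H T Z p) (Inr v) \<longleftrightarrow>
      F \<in> pendant_complex H (T - {u, v}) (insert u Z) (p - 1)"
    unfolding pendant_complex_def eq using assms(8) by auto
qed

text \<open>Induction on a vertex of degree at most one: its link and its deletion are complexes of the
  same kind on smaller forests. In the deletion of a leaf, the drop of \<open>p\<close> is made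
  up for by the new free vertex. For \<open>p = card T + 1\<close> the weight imposes no
  restriction and the complex is a simplex.\<close>

lemma cm_upto_pendant_forest:
  assumes "finite_simple_graph H"
  shows "finite T \<Longrightarrow> finite Z \<Longrightarrow> forest_on H T \<Longrightarrow> T \<inter> Z = {} \<Longrightarrow> p \<le> Suc (card T) \<Longrightarrow>
    cm_upto K (pendant_complex H T Z p) (int (card Z) + int p - 2)"
proof (induction "card T" arbitrary: T Z p rule: less_induct)
  case less
  consider (void) "p = 0" | (simplex) "p = Suc (card T)" | (step) "0 < p" "p \<le> card T"
    using less.prems(5) by linarith
  then show ?case
  proof cases
    case void
    then have "pendant_complex H T Z p = {}"
      by (simp add: pendant_complex_def)
    then show ?thesis
      by (simp add: cm_upto_empty)
  next
    case simplex
    then have "pendant_complex H T Z p = Pow (Inr ` (T \<union> Z))"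
      using weight_le_card[OF assms less.prems(1)] by (auto simp: pendant_complex_def less_Suc_eq_le)
    moreover have "card (Inr ` (T \<union> Z) :: ('a + 'a) set) = card T + card Z"
      using less.prems by (simp add: card_image card_Un_disjoint)
    moreover have "finite (Inr ` (T \<union> Z) :: ('a + 'a) set)"
      using less.prems by simp
    ultimately show ?thesis
      using cm_upto_Pow[of "Inr ` (T \<union> Z) :: ('a + 'a) set" K] simplex by (simp add: algebra_simps)
  next
    case step
    then have "T \<noteq> {}"
      by auto
    then obtain v where v: "v \<in> T" and deg: "card {u \<in> T. {u, v} \<in> edges H} \<le> 1"
      using less.prems(3) unfolding forest_on_def by blast
    have card_v: "card (T - {v}) = card T - 1" "card (T - {v}) < card T"
      using v less.prems(1) step by (auto simp: card_Diff_singleton)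
    have forest: "forest_on H T'" if "T' \<subseteq> T" for T'
      using forest_on_subset[OF less.prems(3) that] .
    note cx = complex_pendant[OF assms less.prems(1,2), of p]
    have link: "cm_upto K (link (pendant_complex H T Z p) {Inr v}) (int (card Z) + int p - 2 - 1)"
    proof -
      have "cm_upto K (pendant_complex H (T - {v}) Z (p - 1)) (int (card Z) + int (p - 1) - 2)"
        using less.prems card_v step by (intro less.hyps forest) auto
      then show ?thesis
        unfolding link_pendant[OF assms less.prems(1,2) v less.prems(4) step(1)]
        using step by (simp add: of_nat_diff algebra_simps)
    qed
    have "cm_upto K (deletion (pendant_complex H T Z p) (Inr v)) (int (card Z) + int p - 2)"
    proof (cases "{u \<in> T. {u, v} \<in> edges H} = {}")
      case True
      have "cm_upto K (pendant_complex H (T - {v}) Z p) (int (card Z) + int p - 2)"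
        using less.prems card_v step by (intro less.hyps forest) auto
      moreover have "deletion (pendant_complex H T Z p) (Inr v) = pendant_complex H (T - {v}) Z p"
        using True by (intro deletion_pendant_isolated[OF assms v less.prems(4)]) blast
      ultimately show ?thesis
        by simp
    next
      case False
      then have "card {u \<in> T. {u, v} \<in> edges H} \<noteq> 0"
        using less.prems(1) by simp
      then have "card {u \<in> T. {u, v} \<in> edges H} = 1"
        using deg by linarith
      then obtain u where N: "{u \<in> T. {u, v} \<in> edges H} = {u}"
        by (rule card_1_singletonE)
      then have u: "u \<in> T" "{u, v} \<in> edges H"
        by blast+
      have del: "deletion (pendant_complex H T Z p) (Inr v) =
          pendant_complex H (T - {u, v}) (insert u Z) (p - 1)"
        by (rule deletion_pendant_leaf[OF assms less.prems(1) v u(1) less.prems(4) u(2) _ step(1)])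
          (use N in blast)
      have "u \<noteq> v"
        using edge_neq[OF assms u(2)] .
      then have card_uv: "card (T - {u, v}) = card T - 2"
        using u(1) v less.prems(1) by (simp add: card_Diff_subset)
      have "card {u, v} \<le> card T"
        using u(1) v less.prems(1) by (intro card_mono) auto
      then have "2 \<le> card T"
        using \<open>u \<noteq> v\<close> by simp
      have "u \<notin> Z"
        using u(1) less.prems(4) by blast
      have "cm_upto K (pendant_complex H (T - {u, v}) (insert u Z) (p - 1))
          (int (card (insert u Z)) + int (p - 1) - 2)"
        using less.prems card_uv \<open>2 \<le> card T\<close> step by (intro less.hyps forest) auto
      moreover have "int (card (insert u Z)) + int (p - 1) - 2 = int (card Z) + int p - 2"
        using \<open>u \<notin> Z\<close> less.prems(2) step by simp
      ultimately show ?thesis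
        unfolding del by simp
    qed
    then show ?thesis
      using link by (rule cm_upto_deletion_link[OF cx])
  qed
qed

text \<open>After all vertices of \<open>T\<close> have been decided, only the simplex on the free
  vertices is left.\<close>

lemma cm_upto_pendant:
  assumes "finite_simple_graph H" and "finite T" and "finite Z" and "T \<inter> Z = {}"
  shows "cm_upto K (pendant_complex H T Z p) (int (card Z) - 1)"
proof -
  let ?\<Gamma> = "pendant_complex H T Z p" and ?U = "Inr ` T :: ('a + 'a) set"
  have base: "cm_upto K (partial_link ?\<Gamma> ?U S R) (int (card Z) - 1 - int (card S))"
    if S: "S \<subseteq> ?U" and "R \<subseteq> ?U" and "card (S \<union> R) = 0 \<or> R = {}" for S R
  proof -
    have fin: "finite ?U"
      using assms(2) by simp
    have "finite (S \<union> R)"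
      using that(1,2) finite_subset[OF _ fin] by simp
    then have R: "R = {}"
      using that(3) by auto
    have eq: "partial_link ?\<Gamma> ?U S R = (if weight H T (Inr -` S) < p then Pow (Inr ` Z) else {})"
    proof -
      have "F \<in> partial_link ?\<Gamma> ?U S {} \<longleftrightarrow> F \<subseteq> Inr ` Z \<and> weight H T (Inr -` S) < p" for F
      proof -
        have "Inr ` Z \<inter> ?U = {}"
          using assms(4) by auto
        then have "F \<inter> S = {} \<and> F \<union> S \<subseteq> Inr ` (T \<union> Z) \<and> F \<inter> ?U \<subseteq> {} \<longleftrightarrow> F \<subseteq> Inr ` Z"
          using S unfolding image_Un by blast
        then have "F \<in> partial_link ?\<Gamma> ?U S {} \<longleftrightarrow>
            F \<subseteq> Inr ` Z \<and> weight H T (Inr -` (F \<union> S)) < p"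
          unfolding partial_link_def pendant_complex_def mem_Collect_eq by argo
        moreover have "weight H T (Inr -` (F \<union> S)) = weight H T (Inr -` S)" if "F \<subseteq> Inr ` Z"
        proof -
          have "T \<inter> Inr -` (F \<union> S) = T \<inter> Inr -` S" "T - Inr -` (F \<union> S) = T - Inr -` S"
            using that assms(4) by auto
          then show ?thesis
            by (simp add: weight_def)
        qed
        ultimately show ?thesis
          by auto
      qed
      then show ?thesis
        unfolding R by auto
    qed
    have "card (Inr ` Z :: ('a + 'a) set) = card Z"
      by (simp add: card_image)
    then have "cm_upto K (Pow (Inr ` Z :: ('a + 'a) set)) (int (card Z) - 1)"
      using cm_upto_Pow[of "Inr ` Z :: ('a + 'a) set" K] assms(3) by simp
    then have "cm_upto K (Pow (Inr ` Z :: ('a + 'a) set)) (int (card Z) - 1 - int (card S))"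
      by (rule cm_upto_mono) simp
    then show ?thesis
      unfolding eq by (simp add: cm_upto_empty)
  qed
  have "finite ?U"
    using assms(2) by simp
  then show ?thesis
    by (rule cm_upto_by_partial_links[OF complex_pendant[OF assms(1-3)] _ le0]) (rule base)
qed


section \<open>Cohen--Macaulayness of the matching-free complexes\<close>

text \<open>Putting the vertices in \<open>S\<close> into the face and deleting all other vertices of
  \<open>H\<close> leaves a condition on pendant vertices only.\<close>

lemma partial_link_whisker:
  assumes "finite_simple_graph H" and "S \<subseteq> verts H"
  shows "partial_link {F \<in> MF q (whisker_graph H). P (Inl -` F)} (Inl ` verts H) (Inl ` S) {} =
    (if P S then pendant_complex H S (verts H - S) q else {})"
proof -
  let ?V = "verts H"
  have "F \<in> partial_link {F \<in> MF q (whisker_graph H). P (Inl -` F)} (Inl ` ?V) (Inl ` S) {} \<longleftrightarrow>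
      P S \<and> F \<in> pendant_complex H S (?V - S) q" for F
  proof (cases "F \<subseteq> Inr ` ?V")
    case True
    then have "Inl -` (F \<union> Inl ` S) = S" "Inr -` (F \<union> Inl ` S) = Inr -` F"
      "F \<union> Inl ` S \<subseteq> ?V <+> ?V" "F \<inter> Inl ` S = {}" "F \<inter> Inl ` ?V = {}"
      using assms(2) by auto
    moreover have "S \<union> (?V - S) = ?V"
      using assms(2) by blast
    ultimately show ?thesis
      using True by (auto simp: partial_link_def MF_whisker[OF assms(1)] pendant_complex_def)
  next
    case False
    then obtain z where z: "z \<in> F" "z \<notin> Inr ` ?V"
      by blast
    have "\<not> (F \<union> Inl ` S \<subseteq> ?V <+> ?V \<and> F \<inter> Inl ` ?V \<subseteq> {})"
      using z unfolding Plus_def by blast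
    moreover have "S \<union> (?V - S) = ?V"
      using assms(2) by blast
    ultimately show ?thesis
      using False by (auto simp: partial_link_def MF_whisker[OF assms(1)] pendant_complex_def)
  qed
  then show ?thesis
    by auto
qed

text \<open>The pendant vertices alone account for this bound, whatever \<open>q\<close> and the cycles of
  \<open>H\<close> are.\<close>

lemma cm_upto_MF:
  assumes "finite_simple_graph H"
  shows "cm_upto K (MF q (whisker_graph H)) (int (card (verts H)) - 1)"
proof -
  let ?V = "verts H"
  let ?U = "Inl ` ?V :: ('a + 'a) set"
  let ?\<Delta> = "{F \<in> MF q (whisker_graph H). True}"
  note V = finite_verts[OF assms]
  have base: "cm_upto K (partial_link ?\<Delta> ?U S R) (int (card ?V) - 1 - int (card S))"
    if S: "S \<subseteq> ?U" and "R \<subseteq> ?U" and "card (S \<union> R) = 0 \<or> R = {}" for S R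
  proof -
    have "finite (S \<union> R)"
      using that(1,2) V finite_subset[of "S \<union> R" ?U] by simp
    then have R: "R = {}"
      using that(3) by auto
    obtain S' where S': "S' \<subseteq> ?V" "S = Inl ` S'"
      using S by (meson subset_imageE)
    have "finite S'"
      using S'(1) V by (rule finite_subset)
    then have d: "int (card ?V) - 1 - int (card S) = int (card (?V - S')) - 1"
      using S' V by (simp add: card_image card_Diff_subset of_nat_diff card_mono)
    have "partial_link ?\<Delta> ?U S R = pendant_complex H S' (?V - S') q"
      unfolding R S'(2) using partial_link_whisker[OF assms S'(1), of q "\<lambda>_. True"] by simp
    moreover have "cm_upto K (pendant_complex H S' (?V - S') q) (int (card (?V - S')) - 1)"
      using V \<open>finite S'\<close> by (intro cm_upto_pendant[OF assms]) auto
    ultimately show ?thesis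
      unfolding d by metis
  qed
  have "finite ?U"
    using V by simp
  have cx: "simplicial_complex ?\<Delta>"
    by (rule complex_MF[OF assms]) simp
  from \<open>finite ?U\<close> have "cm_upto K ?\<Delta> (int (card ?V) - 1)"
    by (rule cm_upto_by_partial_links[OF cx _ le0]) (rule base)
  then show ?thesis
    by simp
qed

text \<open>The subcomplex that carries the faces of maximal size when \<open>q\<close> is at most half
  the girth, rounded up.\<close>

definition forest_faces :: "'a ugraph \<Rightarrow> nat \<Rightarrow> ('a + 'a) set set" where
  "forest_faces H q = {F \<in> MF q (whisker_graph H). forest_on H (Inl -` F)}"

lemma complex_forest_faces: "finite_simple_graph H \<Longrightarrow> simplicial_complex (forest_faces H q)"
  unfolding forest_faces_def by (rule complex_MF) (auto intro: forest_on_subset)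

text \<open>Decide the vertices of \<open>H\<close> one by one. If all are decided, the complex on the
  pendant vertices belongs to a forest. If only \<open>q - 1\<close> vertices of
  \<open>H\<close> are left, then no choice of them and of pendant vertices reaches weight
  \<open>q\<close> or a cycle, so the complex is a simplex of the right dimension.\<close>

lemma cm_upto_forest_faces:
  assumes "finite_simple_graph H" and "1 \<le> q" and "q \<le> card (verts H)"
    and small: "\<And>X. X \<subseteq> verts H \<Longrightarrow> card X < q \<Longrightarrow> forest_on H X"
  shows "cm_upto K (forest_faces H q) (int (card (verts H)) + int q - 2)"
proof -
  let ?V = "verts H"
  let ?n = "card ?V"
  let ?U = "Inl ` ?V :: ('a + 'a) set"
  let ?\<Delta> = "{F \<in> MF q (whisker_graph H). forest_on H (Inl -` F)}"
  note V = finite_verts[OF assms(1)]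
  have base: "cm_upto K (partial_link ?\<Delta> ?U S R) (int ?n + int q - 2 - int (card S))"
    if S: "S \<subseteq> ?U" and R: "R \<subseteq> ?U" and SR: "S \<inter> R = {}" and k: "q - 1 \<le> card (S \<union> R)"
      and stop: "card (S \<union> R) = q - 1 \<or> R = {}" for S R
  proof -
    obtain S' where S': "S' \<subseteq> ?V" "S = Inl ` S'"
      using S by (meson subset_imageE)
    obtain R' where R': "R' \<subseteq> ?V" "R = Inl ` R'"
      using R by (meson subset_imageE)
    have fin: "finite S'" "finite R'"
      using S'(1) R'(1) V finite_subset by auto
    have card: "card S = card S'" "card R = card R'"
      unfolding S' R' by (simp_all add: card_image)
    show ?thesis
    proof (cases "R = {}")
      case True
      have "cm_upto K (pendant_complex H S' (?V - S') q) (int (card (?V - S')) + int q - 2)"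
        if "forest_on H S'"
        using that V fin k True card by (intro cm_upto_pendant_forest[OF assms(1)]) auto
      moreover have d: "int ?n + int q - 2 - int (card S) = int (card (?V - S')) + int q - 2"
        using S' V fin card by (simp add: card_Diff_subset of_nat_diff card_mono)
      have eq: "partial_link ?\<Delta> ?U S R =
          (if forest_on H S' then pendant_complex H S' (?V - S') q else {})"
        unfolding True S'(2) by (rule partial_link_whisker[OF assms(1) S'(1)])
      ultimately show ?thesis
        unfolding eq d by (simp add: cm_upto_empty)
    next
      case False
      have sum: "card S' + card R' = q - 1"
        using stop False SR card S' R' fin by (simp add: card_Un_disjoint)
      have "partial_link ?\<Delta> ?U S R = Pow (Inl ` R' \<union> Inr ` ?V)"
      proof (intro set_eqI iffI)
        fix F assume "F \<in> partial_link ?\<Delta> ?U S R"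
        then have "F \<subseteq> ?V <+> ?V" "F \<inter> ?U \<subseteq> Inl ` R'"
          unfolding partial_link_def MF_whisker[OF assms(1)] R'(2) by auto
        then show "F \<in> Pow (Inl ` R' \<union> Inr ` ?V)"
          unfolding Plus_def by blast
      next
        fix F assume F: "F \<in> Pow (Inl ` R' \<union> Inr ` ?V)"
        let ?X = "Inl -` (F \<union> S)"
        have XSR: "?X \<subseteq> S' \<union> R'"
          using F unfolding S'(2) by auto
        then have "card ?X \<le> card (S' \<union> R')"
          using fin by (intro card_mono) auto
        also have "\<dots> \<le> q - 1"
          using sum card_Un_le[of S' R'] by simp
        finally have X: "card ?X < q"
          using assms(2) by linarith
        moreover have XV: "?X \<subseteq> ?V"
          using XSR S'(1) R'(1) by blast
        ultimately have "forest_on H ?X"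
          by (intro small)
        moreover have "weight H ?X (Inr -` (F \<union> S)) < q"
          using weight_le_card[OF assms(1), of ?X "Inr -` (F \<union> S)"] X XV V finite_subset[of ?X ?V]
          by linarith
        moreover have "F \<union> S \<subseteq> ?V <+> ?V"
          using F S' R'(1) by auto
        ultimately have "F \<union> S \<in> ?\<Delta>"
          by (simp add: MF_whisker[OF assms(1)])
        moreover have "F \<inter> S = {}"
          using F SR unfolding S'(2) R'(2) by auto
        moreover have "F \<inter> ?U \<subseteq> R"
          using F unfolding R'(2) by auto
        ultimately show "F \<in> partial_link ?\<Delta> ?U S R"
          unfolding partial_link_def by blast
      qed
      moreover have "card (Inl ` R' \<union> Inr ` ?V :: ('a + 'a) set) = card R' + ?n"
        using fin V by (subst card_Un_disjoint) (auto simp: card_image)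
      moreover have "finite (Inl ` R' \<union> Inr ` ?V :: ('a + 'a) set)"
        using fin V by simp
      moreover have "int ?n + int q - 2 - int (card S) = int (card R' + ?n) - 1"
        using sum card assms(2) by linarith
      ultimately show ?thesis
        using cm_upto_Pow[of "Inl ` R' \<union> Inr ` ?V :: ('a + 'a) set" K] by metis
    qed
  qed
  have "q - 1 \<le> card ?U"
    using assms(3) by (simp add: card_image)
  moreover have "finite ?U"
    using V by simp
  ultimately show ?thesis
    unfolding forest_faces_def
    using cm_upto_by_partial_links[OF complex_forest_faces[OF assms(1), unfolded forest_faces_def]] base
    by blast
qed

lemma face_card_le:
  assumes "finite_simple_graph H" and "F \<in> MF q (whisker_graph H)" and "1 \<le> q"
  shows "card F \<le> card (verts H) + q - 1"
proof -
  have FV: "F \<subseteq> verts H <+> verts H" and w: "weight H (Inl -` F) (Inr -` F) < q"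
    using assms(2) MF_whisker[OF assms(1)] by auto
  have "card (Inl -` F \<union> Inr -` F) \<le> card (verts H)"
    using FV by (intro card_mono finite_verts[OF assms(1)]) auto
  then show ?thesis
    using w assms(3) face_card[OF assms(1) FV] unfolding weight_def by linarith
qed

lemma cycle_subset_verts:
  assumes "finite_simple_graph H" and "cycle H p"
  shows "set p \<subseteq> verts H"
proof
  fix x assume "x \<in> set p"
  then obtain i where "i < length p" "x = p ! i"
    by (metis in_set_conv_nth)
  then have "{x, p ! (Suc i mod length p)} \<in> edges H"
    using assms(2) unfolding cycle_def by blast
  then show "x \<in> verts H"
    using edge_subset[OF assms(1)] by blast
qed

lemma forest_on_small:
  assumes "finite_simple_graph H" and "X \<subseteq> verts H" and "\<And>p. cycle H p \<Longrightarrow> card X < length p"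
  shows "forest_on H X"
proof (rule ccontr)
  have fin: "finite X"
    using assms(2) finite_verts[OF assms(1)] by (rule finite_subset)
  assume "\<not> forest_on H X"
  then obtain p where p: "cycle H p" "set p \<subseteq> X"
    using cycle_if_not_forest[OF assms(1) fin] by blast
  then have "length p \<le> card X"
    using card_mono[OF fin p(2)] distinct_card[of p] by (simp add: cycle_def)
  then show False
    using assms(3)[OF p(1)] by simp
qed

text \<open>A cycle in a face would contain a matching of size \<open>q\<close>, so all faces are acyclic
  on \<open>H\<close>.\<close>

theorem cohen_macaulay_MF:
  assumes "finite_simple_graph H" and "1 \<le> q" and "q \<le> card (verts H)"
    and "\<And>p. cycle H p \<Longrightarrow> q \<le> length p div 2"
  shows "cohen_macaulay K (MF q (whisker_graph H))"
proof -
  have "forest_on H (Inl -` F)" if F: "F \<in> MF q (whisker_graph H)" for F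
  proof (rule ccontr)
    let ?X = "Inl -` F"
    have FV: "F \<subseteq> verts H <+> verts H" and w: "weight H ?X (Inr -` F) < q"
      using F MF_whisker[OF assms(1)] by auto
    have fin: "finite ?X"
      using FV by (intro finite_subset[OF _ finite_verts[OF assms(1)]]) auto
    assume "\<not> forest_on H ?X"
    then obtain p where p: "cycle H p" "set p \<subseteq> ?X"
      using cycle_if_not_forest[OF assms(1) fin] by blast
    have "q \<le> length p div 2"
      using assms(4)[OF p(1)] .
    also have "\<dots> \<le> weight H ?X {}"
      using cycle_matching[OF assms(1) p] by (simp add: weight_def)
    also have "\<dots> \<le> weight H ?X (Inr -` F)"
      by (intro weight_mono[OF assms(1) fin]) auto
    finally show False
      using w by simp
  qed
  then have eq: "forest_faces H q = MF q (whisker_graph H)"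
    by (auto simp: forest_faces_def)
  have "cm_upto K (forest_faces H q) (int (card (verts H)) + int q - 2)"
  proof (rule cm_upto_forest_faces[OF assms(1-3)])
    fix X assume "X \<subseteq> verts H" "card X < q"
    moreover have "card X < length p" if "cycle H p" for p
      using assms(4)[OF that] \<open>card X < q\<close> div_le_dividend[of "length p" 2] by linarith
    ultimately show "forest_on H X"
      by (intro forest_on_small[OF assms(1)]) auto
  qed
  then show ?thesis
    unfolding eq
  proof (rule cohen_macaulay_if_cm_upto[rotated 2])
    show "finite (MF q (whisker_graph H))"
      by (rule finite_MF[OF assms(1)])
    show "simplicial_complex (MF q (whisker_graph H))"
      using complex_forest_faces[OF assms(1), of q] eq by simp
    fix F assume "F \<in> MF q (whisker_graph H)"
    then show "int (card F) \<le> int (card (verts H)) + int q - 2 + 1"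
      using face_card_le[OF assms(1)] assms(2) by force
  qed
qed

text \<open>A face with more than \<open>card (verts H)\<close> elements contains a whisker, say at
  \<open>a\<close>. If it also contained a cycle, then the cycle without \<open>a\<close> would
  still have a matching of size \<open>m div 2\<close>, as \<open>m\<close> is odd, and together
  with the whisker this is too much.\<close>

lemma forest_if_large_face:
  assumes "finite_simple_graph H" and "odd m" and "\<And>p. cycle H p \<Longrightarrow> m \<le> length p"
    and "F \<in> MF ((m + 1) div 2) (whisker_graph H)" and "card (verts H) < card F"
  shows "forest_on H (Inl -` F)"
proof (rule ccontr)
  let ?X = "Inl -` F" and ?Y = "Inr -` F"
  have FV: "F \<subseteq> verts H <+> verts H" and w: "weight H ?X ?Y < (m + 1) div 2"
    using assms(4) MF_whisker[OF assms(1)] by auto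
  have fin: "finite ?X"
    using FV by (intro finite_subset[OF _ finite_verts[OF assms(1)]]) auto
  assume "\<not> forest_on H ?X"
  then obtain p where p: "cycle H p" "set p \<subseteq> ?X"
    using cycle_if_not_forest[OF assms(1) fin] by blast
  have "card (?X \<union> ?Y) \<le> card (verts H)"
    using FV by (intro card_mono finite_verts[OF assms(1)]) auto
  then have "card (?X \<inter> ?Y) \<noteq> 0"
    using face_card[OF assms(1) FV] assms(5) by linarith
  then obtain a where a: "a \<in> ?X" "a \<in> ?Y"
    by (metis IntE all_not_in_conv card.empty)
  have "(m + 1) div 2 \<le> Suc ((length p - 1) div 2)"
    using assms(3)[OF p(1)] assms(2) by presburger
  also have "\<dots> \<le> Suc (nu H (?X - {a}))"
    using cycle_remove_vertex_matching[OF assms(1) p] by simp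
  also have "\<dots> = weight H ?X {a}"
    using weight_insert[OF fin a(1), of "{}" H] by simp
  also have "\<dots> \<le> weight H ?X ?Y"
    using a by (intro weight_mono[OF assms(1) fin]) auto
  finally show False
    using w by simp
qed

text \<open>Pure skeleta of dimension below \<open>card (verts H)\<close> are covered by the bound that
  holds for all \<open>q\<close>. The faces of larger dimension are acyclic on \<open>H\<close>,
  so the higher pure skeleta are those of the subcomplex of acyclic faces.\<close>

theorem sequentially_cohen_macaulay_MF:
  assumes "finite_simple_graph H" and "odd m" and "\<And>p. cycle H p \<Longrightarrow> m \<le> length p"
    and "(m + 1) div 2 \<le> card (verts H)"
  shows "sequentially_cohen_macaulay K (MF ((m + 1) div 2) (whisker_graph H))"
  unfolding sequentially_cohen_macaulay_def
proof
  let ?n = "card (verts H)" and ?q = "(m + 1) div 2"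
  let ?\<Delta> = "MF ?q (whisker_graph H)"
  fix d :: int
  have q: "1 \<le> ?q" "?q \<le> m"
    using assms(2) by presburger+
  consider (low) "d \<le> int ?n - 1" | (mid) "int ?n \<le> d" "d \<le> int ?n + int ?q - 2"
    | (high) "int ?n + int ?q - 2 < d"
    by linarith
  then show "cohen_macaulay K (pure_skeleton ?\<Delta> d)"
  proof cases
    case low
    have "simplicial_complex ?\<Delta>"
      using complex_MF[OF assms(1), of "\<lambda>_. True"] by simp
    then show ?thesis
      by (rule cohen_macaulay_pure_skeleton[OF finite_MF[OF assms(1)] _ cm_upto_MF[OF assms(1)] low])
  next
    case mid
    have "\<sigma> \<in> forest_faces H ?q" if "\<sigma> \<in> ?\<Delta>" "face_dim \<sigma> = d" for \<sigma>
      using forest_if_large_face[OF assms(1-3) that(1)] that mid(1)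
      by (simp add: face_dim_def forest_faces_def)
    moreover have "forest_faces H ?q \<subseteq> ?\<Delta>"
      by (auto simp: forest_faces_def)
    ultimately have eq: "pure_skeleton ?\<Delta> d = pure_skeleton (forest_faces H ?q) d"
      unfolding pure_skeleton_def by blast
    have "cm_upto K (forest_faces H ?q) (int ?n + int ?q - 2)"
    proof (rule cm_upto_forest_faces[OF assms(1) q(1) assms(4)])
      fix X assume "X \<subseteq> verts H" "card X < ?q"
      moreover have "card X < length p" if "cycle H p" for p
        using assms(3)[OF that] \<open>card X < ?q\<close> q(2) by linarith
      ultimately show "forest_on H X"
        by (intro forest_on_small[OF assms(1)]) auto
    qed
    moreover have "finite (forest_faces H ?q)"
      using finite_subset[OF \<open>forest_faces H ?q \<subseteq> ?\<Delta>\<close> finite_MF[OF assms(1)]] .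
    ultimately show ?thesis
      unfolding eq using mid(2) complex_forest_faces[OF assms(1)]
      by (intro cohen_macaulay_pure_skeleton[where e = "int ?n + int ?q - 2"])
  next
    case high
    have "face_dim \<sigma> \<noteq> d" if "\<sigma> \<in> ?\<Delta>" for \<sigma>
      using face_card_le[OF assms(1) that q(1)] high q(1) by (simp add: face_dim_def)
    then have "pure_skeleton ?\<Delta> d = {}"
      by (auto simp: pure_skeleton_def)
    then show ?thesis
      by (simp add: cohen_macaulay_def)
  qed
qed


section \<open>Purity\<close>

text \<open>The pendant vertex of a vertex outside \<open>X\<close> can be added without changing the
  weight, and adding any vertex raises the weight by at most one. A vertex \<open>b\<close> of
  \<open>X - Y\<close> whose removal lowered the matching number could move into
  \<open>Y\<close> at no cost.\<close>

lemma facet_whisker: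
  assumes "finite_simple_graph H" and "1 \<le> q" and "q \<le> card (verts H)"
    and "facet (MF q (whisker_graph H)) F"
  shows "Inl -` F \<union> Inr -` F = verts H"
    and "Suc (weight H (Inl -` F) (Inr -` F)) = q"
    and "\<And>b. b \<in> Inl -` F - Inr -` F \<Longrightarrow>
      nu H (Inl -` F - Inr -` F - {b}) = nu H (Inl -` F - Inr -` F)"
    and "card F = card (verts H) + card (Inl -` F \<inter> Inr -` F)"
proof -
  let ?V = "verts H" and ?X = "Inl -` F" and ?Y = "Inr -` F" and ?\<Delta> = "MF q (whisker_graph H)"
  have F: "F \<in> ?\<Delta>"
    using assms(4) by (simp add: facet_def)
  then have FV: "F \<subseteq> ?V <+> ?V" and w: "weight H ?X ?Y < q"
    using MF_whisker[OF assms(1)] by auto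
  have XV: "?X \<subseteq> ?V" and YV: "?Y \<subseteq> ?V"
    using FV by auto
  have fin: "finite ?X"
    using finite_subset[OF XV finite_verts[OF assms(1)]] .
  have max: "insert z F \<notin> ?\<Delta>" if "z \<notin> F" for z
    using assms(4) that unfolding facet_def by blast
  have maxY: "q \<le> weight H ?X (insert a ?Y)" if "a \<in> ?V" "a \<notin> ?Y" for a
  proof -
    have "Inl -` insert (Inr a) F = ?X" "Inr -` insert (Inr a) F = insert a ?Y"
      by auto
    then show ?thesis
      using max[of "Inr a"] that FV by (auto simp: MF_whisker[OF assms(1)])
  qed
  have maxX: "q \<le> weight H (insert a ?X) ?Y" if "a \<in> ?V" "a \<notin> ?X" for a
  proof -
    have "Inl -` insert (Inl a) F = insert a ?X" "Inr -` insert (Inl a) F = ?Y"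
      by auto
    then show ?thesis
      using max[of "Inl a"] that FV by (auto simp: MF_whisker[OF assms(1)])
  qed
  show cover: "?X \<union> ?Y = ?V"
  proof (rule ccontr)
    assume "\<not> ?thesis"
    then obtain a where a: "a \<in> ?V" "a \<notin> ?X" "a \<notin> ?Y"
      using XV YV by blast
    then have "?X \<inter> insert a ?Y = ?X \<inter> ?Y" "?X - insert a ?Y = ?X - ?Y"
      by blast+
    then have "weight H ?X (insert a ?Y) = weight H ?X ?Y"
      by (simp add: weight_def)
    then show False
      using maxY[OF a(1,3)] w by simp
  qed
  have "q \<le> Suc (weight H ?X ?Y)"
  proof (cases "?X = ?V \<and> ?Y = ?V")
    case True
    then have "card ?V \<le> weight H ?X ?Y"
      by (simp add: weight_def)
    then show ?thesis
      using assms(3) by linarith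
  next
    case False
    then obtain a where "a \<in> ?V" "a \<notin> ?X \<or> a \<notin> ?Y"
      using XV YV by blast
    then show ?thesis
      using maxX[of a] maxY[of a] weight_insert_le[OF assms(1) fin, of a ?Y] by linarith
  qed
  then show weight: "Suc (weight H ?X ?Y) = q"
    using w by linarith
  show "nu H (?X - ?Y - {b}) = nu H (?X - ?Y)" if b: "b \<in> ?X - ?Y" for b
  proof (rule antisym)
    show "nu H (?X - ?Y - {b}) \<le> nu H (?X - ?Y)"
      by (intro nu_mono[OF assms(1)]) blast
    have "q \<le> Suc (card (?X \<inter> ?Y) + nu H (?X - ?Y - {b}))"
      using maxY[of b] weight_insert[OF fin, of b ?Y H] b XV by auto
    then show "nu H (?X - ?Y) \<le> nu H (?X - ?Y - {b})"
      using weight unfolding weight_def by linarith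
  qed
  show "card F = card ?V + card (?X \<inter> ?Y)"
    using face_card[OF assms(1) FV] cover by simp
qed

lemma edge_if_nu_pos:
  assumes "finite_simple_graph H" and "0 < nu H B"
  obtains e where "e \<in> edges H" and "e \<subseteq> B"
proof -
  obtain M where M: "matching (induced_subgraph H B) M" "card M = nu H B"
    using maximum_matching[OF assms(1)] .
  then obtain e where "e \<in> M"
    using assms(2) by fastforce
  then show ?thesis
    using M(1) that by (auto simp: matching_induced)
qed

lemma facet_card_if_bipartite:
  assumes "finite_simple_graph H" and "1 \<le> q" and "q \<le> card (verts H)"
    and "facet (MF q (whisker_graph H)) F"
    and "bipartite (induced_subgraph H (Inl -` F - Inr -` F))"
  shows "card F = card (verts H) + q - 1"
proof -
  let ?B = "Inl -` F - Inr -` F"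
  note F = facet_whisker[OF assms(1-4)]
  have "nu H ?B = 0"
  proof (rule ccontr)
    assume "nu H ?B \<noteq> 0"
    then obtain e where "e \<in> edges H" "e \<subseteq> ?B"
      using edge_if_nu_pos[OF assms(1), of ?B] by blast
    then obtain b where "b \<in> ?B" "nu H (?B - {b}) < nu H ?B"
      using bipartite_essential_vertex[OF assms(1,5)] by blast
    then show False
      using F(3) by simp
  qed
  then show ?thesis
    using F(2,4) by (simp add: weight_def)
qed

text \<open>The odd cycle lies in the part \<open>B\<close> of \<open>H\<close> without pendant vertices
  in the facet, whence the first bound. The second bound holds because some maximum matching of
  \<open>B\<close> misses a vertex, so that \<open>B\<close> has more than \<open>2 * nu H
  B\<close> elements.\<close>

lemma facet_odd_cycle:
  assumes "finite_simple_graph H" and "1 \<le> q" and "q \<le> card (verts H)"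
    and "facet (MF q (whisker_graph H)) F"
    and "\<not> bipartite (induced_subgraph H (Inl -` F - Inr -` F))"
  obtains p where "cycle H p" and "odd (length p)"
    and "length p div 2 < q" and "q + length p div 2 \<le> card (verts H)"
proof -
  let ?X = "Inl -` F" and ?Y = "Inr -` F"
  let ?B = "?X - ?Y"
  note F = facet_whisker[OF assms(1-4)]
  have BV: "?B \<subseteq> verts H"
    using F(1) by blast
  have finX: "finite ?X"
    using F(1) finite_verts[OF assms(1)] by (metis finite_Un)
  obtain p where "cycle (induced_subgraph H ?B) p" "odd (length p)"
    by (rule odd_cycle_if_not_bipartite[OF finite_simple_induced[OF assms(1) BV] assms(5)])
  then have p: "cycle H p" "set p \<subseteq> ?B" "odd (length p)"
    by (simp_all add: cycle_induced)
  have nu: "length p div 2 \<le> nu H ?B"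
    using cycle_matching[OF assms(1) p(1,2)] .
  have "p \<noteq> []"
    using p(1) by (auto simp: cycle_def)
  then obtain b where b: "b \<in> ?B"
    using p(2) by (metis hd_in_set subsetD)
  have "2 * nu H ?B \<le> card (?B - {b})"
    using nu_le_half[OF assms(1), of "?B - {b}"] F(3)[OF b] finX by simp
  moreover have "card ?B = Suc (card (?B - {b}))"
    using b finX by (metis card.remove finite_Diff)
  moreover have "card (?X \<inter> ?Y) + card ?B \<le> card (verts H)"
  proof -
    have "card (?X \<inter> ?Y) + card ?B = card ?X"
      using card_Int_Diff[OF finX, of ?Y] by simp
    also have "\<dots> \<le> card (verts H)"
      using F(1) by (intro card_mono finite_verts[OF assms(1)]) blast
    finally show ?thesis .
  qed
  ultimately have "q + nu H ?B \<le> card (verts H)"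
    using F(2) unfolding weight_def by linarith
  then have "q + length p div 2 \<le> card (verts H)"
    using nu by linarith
  moreover have "length p div 2 < q"
    using nu F(2) unfolding weight_def by linarith
  ultimately show ?thesis
    using that p(1,3) by blast
qed

lemma pure_if_card:
  assumes "\<And>F. facet \<Delta> F \<Longrightarrow> card F = c"
  shows "pure \<Delta>"
  using assms by (simp add: pure_def face_dim_def)

lemma facet_whiskerI:
  assumes "finite_simple_graph H" and "X \<subseteq> verts H" and "Y \<subseteq> verts H" and "weight H X Y < q"
    and "\<And>a. a \<in> verts H \<Longrightarrow> a \<notin> X \<Longrightarrow> q \<le> weight H (insert a X) Y"
    and "\<And>a. a \<in> verts H \<Longrightarrow> a \<notin> Y \<Longrightarrow> q \<le> weight H X (insert a Y)"
  shows "facet (MF q (whisker_graph H)) (X <+> Y)"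
  unfolding facet_def
proof (intro conjI ballI impI)
  let ?V = "verts H"
  have XY: "Inl -` (X <+> Y) = X" "Inr -` (X <+> Y) = Y"
    by auto
  show "X <+> Y \<in> MF q (whisker_graph H)"
    unfolding MF_whisker[OF assms(1)] XY using assms(2-4) by auto
  fix F assume F: "F \<in> MF q (whisker_graph H)" and sub: "X <+> Y \<subseteq> F"
  have FV: "F \<subseteq> ?V <+> ?V" and w: "weight H (Inl -` F) (Inr -` F) < q"
    using F MF_whisker[OF assms(1)] by auto
  have fin: "finite (Inl -` F)"
    using FV by (intro finite_subset[OF _ finite_verts[OF assms(1)]]) auto
  have X: "X \<subseteq> Inl -` F" and Y: "Y \<subseteq> Inr -` F"
    using sub by auto
  have "Inl -` F \<subseteq> X"
  proof (rule ccontr)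
    assume "\<not> ?thesis"
    then obtain a where a: "Inl a \<in> F" "a \<notin> X"
      by blast
    have "q \<le> weight H (insert a X) Y"
      using a FV by (intro assms(5)) auto
    also have "\<dots> \<le> weight H (Inl -` F) (Inr -` F)"
      using a X Y by (intro weight_mono[OF assms(1) fin]) auto
    finally show False
      using w by simp
  qed
  moreover have "Inr -` F \<subseteq> Y"
  proof (rule ccontr)
    assume "\<not> ?thesis"
    then obtain a where a: "Inr a \<in> F" "a \<notin> Y"
      by blast
    have "q \<le> weight H X (insert a Y)"
      using a FV by (intro assms(6)) auto
    also have "\<dots> \<le> weight H (Inl -` F) (Inr -` F)"
      using a X Y by (intro weight_mono[OF assms(1) fin]) auto
    finally show False
      using w by simp
  qed
  ultimately have "z \<in> X <+> Y" if "z \<in> F" for z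
    using that by (cases z) auto
  then show "F = X <+> Y"
    using sub by blast
qed

text \<open>One facet contains the cycle without its pendant vertices, and enough whiskers to reach weight
  \<open>q - 1\<close>; an odd cycle has the same matching number after the removal of a vertex,
  so no pendant vertex of the cycle can be added. The other facet consists of all pendant
  vertices and \<open>q - 1\<close> vertices of \<open>H\<close>. A facet covering \<open>verts
  H\<close> is larger than \<open>card (verts H)\<close> by the number of its whiskers, and the
  first facet has fewer of them.\<close>

lemma not_pure_MF:
  assumes "finite_simple_graph H" and "cycle H p" and "odd (length p)"
    and "length p div 2 < q" and "q + length p div 2 \<le> card (verts H)"
  shows "\<not> pure (MF q (whisker_graph H))"
proof
  let ?V = "verts H" and ?C = "set p" and ?l = "length p"
  let ?n = "card ?V"
  note V = finite_verts[OF assms(1)]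
  assume pure: "pure (MF q (whisker_graph H))"
  have CV: "?C \<subseteq> ?V"
    using cycle_subset_verts[OF assms(1,2)] .
  have C: "card ?C = ?l" "3 \<le> ?l"
    using assms(2) by (auto simp: cycle_def distinct_card)
  \<comment> \<open>Both equations rest on the parity of the length.\<close>
  have half: "?l = Suc (2 * (?l div 2))" "(?l - 1) div 2 = ?l div 2"
    using assms(3) by presburger+
  have nuC: "nu H ?C = ?l div 2"
    using cycle_matching[OF assms(1,2) order.refl] nu_le_half[OF assms(1), of ?C] C(1) by simp
  have "q - 1 - ?l div 2 \<le> card (?V - ?C)"
    using assms(5) half(1) C(1) CV by (simp add: card_Diff_subset)
  then obtain A where A: "A \<subseteq> ?V - ?C" "card A = q - 1 - ?l div 2"
    by (meson obtain_subset_with_card_n)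
  have finA: "finite A"
    using A(1) V finite_subset by blast
  have AC: "(?C \<union> A) \<inter> (?V - ?C) = A" "(?C \<union> A) - (?V - ?C) = ?C"
    using A(1) CV by blast+
  have w: "weight H (?C \<union> A) (?V - ?C) = q - 1"
    unfolding weight_def AC using A(2) nuC assms(4) by simp
  have "facet (MF q (whisker_graph H)) ((?C \<union> A) <+> (?V - ?C))"
  proof (rule facet_whiskerI[OF assms(1)])
    show "?C \<union> A \<subseteq> ?V" "?V - ?C \<subseteq> ?V"
      using A(1) CV by auto
    show "weight H (?C \<union> A) (?V - ?C) < q"
      using w assms(4) by simp
    show "q \<le> weight H (insert a (?C \<union> A)) (?V - ?C)" if "a \<in> ?V" "a \<notin> ?C \<union> A" for a
      using weight_insert_left[of "?C \<union> A" a "?V - ?C" H] that finA w by simp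
    show "q \<le> weight H (?C \<union> A) (insert a (?V - ?C))" if "a \<in> ?V" "a \<notin> ?V - ?C" for a
    proof -
      have "weight H (?C \<union> A) (insert a (?V - ?C)) = Suc (card A + nu H (?C - {a}))"
        using weight_insert[of "?C \<union> A" a "?V - ?C" H] that finA unfolding AC by simp
      moreover have "?l div 2 \<le> nu H (?C - {a})"
        using cycle_remove_vertex_matching[OF assms(1,2) order.refl, of a] half(2) by simp
      ultimately show ?thesis
        using A(2) assms(4) by linarith
    qed
  qed
  moreover have "card ((?C \<union> A) <+> (?V - ?C)) = ?n + card A"
  proof -
    have "card (?C \<union> A) = card ?C + card A"
      using A(1) finA by (intro card_Un_disjoint) auto
    moreover have "card (?V - ?C) = ?n - card ?C" "card ?C \<le> ?n"
      using CV V by (simp_all add: card_Diff_subset card_mono)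
    ultimately show ?thesis
      using V finA by (simp add: card_Plus)
  qed
  moreover obtain A' where A': "A' \<subseteq> ?V" "card A' = q - 1"
    using assms(5) by (metis obtain_subset_with_card_n diff_le_self le_add1 le_trans)
  have finA': "finite A'"
    using A'(1) V by (rule finite_subset)
  have w': "weight H A' ?V = q - 1"
  proof -
    have "A' \<inter> ?V = A'" "A' - ?V = {}"
      using A'(1) by blast+
    moreover have "nu H {} = 0"
      using nu_le_half[OF assms(1), of "{}"] by simp
    ultimately show ?thesis
      using A'(2) by (simp only: weight_def)
  qed
  have "facet (MF q (whisker_graph H)) (A' <+> ?V)"
  proof (rule facet_whiskerI[OF assms(1) A'(1) order.refl])
    show "weight H A' ?V < q"
      using w' assms(4) by simp
    show "q \<le> weight H (insert a A') ?V" if "a \<in> ?V" "a \<notin> A'" for a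
      using weight_insert_left[OF finA' that(2,1)] w' by simp
  qed simp
  moreover have "card (A' <+> ?V) = q - 1 + ?n"
    using finA' V A'(2) by (simp add: card_Plus)
  ultimately have "q - 1 = card A"
    using pure unfolding pure_def face_dim_def by (metis add.commute add_left_cancel diff_add_cancel of_nat_eq_iff)
  then show False
    using A(2) C(2) assms(4) by linarith
qed


section \<open>The classification\<close>

lemma girth_attained:
  assumes "cycle H p"
  obtains p' where "cycle H p'" and "girth H = enat (length p')"
proof -
  have "girth H \<in> {enat (length p) | p. cycle H p}"
    unfolding girth_def by (rule wellorder_InfI) (use assms in blast)
  then show ?thesis
    using that by blast
qed

lemma odd_girth_attained:
  assumes "cycle H p" and "odd (length p)"
  obtains p' where "cycle H p'" and "odd (length p')" and "odd_girth H = enat (length p')"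
proof -
  have "odd_girth H \<in> {enat (length p) | p. cycle H p \<and> odd (length p)}"
    unfolding odd_girth_def by (rule wellorder_InfI) (use assms in blast)
  then show ?thesis
    using that by blast
qed

lemma girth_le: "cycle H p \<Longrightarrow> girth H \<le> enat (length p)"
  unfolding girth_def by (rule Inf_lower) blast

lemma odd_girth_le: "cycle H p \<Longrightarrow> odd (length p) \<Longrightarrow> odd_girth H \<le> enat (length p)"
  unfolding odd_girth_def by (rule Inf_lower) blast

lemma pure_MF_if_bipartite:
  assumes "finite_simple_graph H" and "1 \<le> q" and "q \<le> card (verts H)" and "bipartite H"
  shows "pure (MF q (whisker_graph H))"
proof (rule pure_if_card)
  fix F assume F: "facet (MF q (whisker_graph H)) F"
  have "Inl -` F - Inr -` F \<subseteq> verts H"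
    using facet_whisker(1)[OF assms(1-3) F] by blast
  then show "card F = card (verts H) + q - 1"
    using bipartite_induced[OF assms(4)] by (intro facet_card_if_bipartite[OF assms(1-3) F])
qed

lemma pure_MF_if_odd_girth:
  assumes "finite_simple_graph H" and "1 \<le> q" and "q \<le> card (verts H)"
    and "\<And>p. cycle H p \<Longrightarrow> odd (length p) \<Longrightarrow> l \<le> length p"
    and "q \<le> l div 2 \<or> card (verts H) < q + l div 2"
  shows "pure (MF q (whisker_graph H))"
proof (rule pure_if_card)
  fix F assume F: "facet (MF q (whisker_graph H)) F"
  show "card F = card (verts H) + q - 1"
  proof (rule facet_card_if_bipartite[OF assms(1-3) F], rule ccontr)
    assume "\<not> bipartite (induced_subgraph H (Inl -` F - Inr -` F))"
    then obtain p where p: "cycle H p" "odd (length p)" "length p div 2 < q"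
        "q + length p div 2 \<le> card (verts H)"
      by (rule facet_odd_cycle[OF assms(1-3) F])
    have "l div 2 \<le> length p div 2"
      using assms(4)[OF p(1,2)] by (rule div_le_mono)
    then show False
      using assms(5) p(3,4) by linarith
  qed
qed

theorem corollary5p11:
  fixes H :: "'a ugraph" and G :: "('a + 'a) ugraph" and n q :: nat
  assumes "finite_simple_graph H"
    and "card (verts H) = n"
    and "G = whisker_graph H"
    and "1 \<le> q" and "q \<le> matching_number G"
  shows
    "(bipartite H \<longrightarrow>
        (\<forall>m. girth H = enat m \<longrightarrow>
           (1 \<le> q \<and> q \<le> m div 2 \<longrightarrow> cohen_macaulay TYPE('k::field) (MF q G)) \<and>
           (m div 2 < q \<and> q \<le> matching_number G \<longrightarrow> pure (MF q G))) \<and>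
        (girth H = \<infinity> \<longrightarrow> cohen_macaulay TYPE('k) (MF q G))) \<and>
     (\<not> bipartite H \<longrightarrow>
        (\<exists>m l. girth H = enat m \<and> odd_girth H = enat l \<and>
           (even m \<longrightarrow>
              (1 \<le> q \<and> q \<le> m div 2 \<longrightarrow> cohen_macaulay TYPE('k) (MF q G)) \<and>
              (m div 2 < q \<and> q < (l + 1) div 2 \<longrightarrow> pure (MF q G)) \<and>
              ((l + 1) div 2 \<le> q \<and> q \<le> n - l div 2 \<longrightarrow> \<not> pure (MF q G)) \<and>
              (n - l div 2 < q \<and> q \<le> matching_number G \<longrightarrow> pure (MF q G))) \<and>
           (odd m \<longrightarrow>
              m = l \<and>
              (1 \<le> q \<and> q < (m + 1) div 2 \<longrightarrow> cohen_macaulay TYPE('k) (MF q G)) \<and>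
              (q = (m + 1) div 2 \<longrightarrow>
                 sequentially_cohen_macaulay TYPE('k) (MF q G) \<and> \<not> pure (MF q G)) \<and>
              ((m + 1) div 2 < q \<and> q \<le> n - m div 2 \<longrightarrow> \<not> pure (MF q G)) \<and>
              (n - m div 2 < q \<and> q \<le> matching_number G \<longrightarrow> pure (MF q G)))))"
proof -
  note H = assms(1) and G = assms(3) and n = assms(2)
  have q1: "1 \<le> q" and qn: "q \<le> card (verts H)"
    using assms matching_number_whisker[OF H] by auto
  have CM: "cohen_macaulay TYPE('k) (MF q G)" if "girth H = enat m" "q \<le> m div 2" for m
    unfolding G
  proof (rule cohen_macaulay_MF[OF H q1 qn])
    fix p assume "cycle H p"
    then have "m \<le> length p"
      using girth_le[of H p] that(1) by simp
    then show "q \<le> length p div 2"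
      using that(2) div_le_mono[of m "length p" 2] by linarith
  qed
  have CM_forest: "cohen_macaulay TYPE('k) (MF q G)" if "girth H = \<infinity>"
    unfolding G
  proof (rule cohen_macaulay_MF[OF H q1 qn])
    fix p assume "cycle H p"
    then show "q \<le> length p div 2"
      using girth_le[of H p] that by simp
  qed
  show ?thesis
  proof (cases "bipartite H")
    case True
    then show ?thesis
      using CM CM_forest pure_MF_if_bipartite[OF H q1 qn] unfolding G by blast
  next
    case False
    then obtain p0 where p0: "cycle H p0" "odd (length p0)"
      using odd_cycle_if_not_bipartite[OF H] by blast
    obtain p where p: "cycle H p" "girth H = enat (length p)"
      using girth_attained[OF p0(1)] .
    obtain c where c: "cycle H c" "odd (length c)" "odd_girth H = enat (length c)"
      using odd_girth_attained[OF p0] .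
    let ?m = "length p" and ?l = "length c"
    have m_le: "?m \<le> length r" if "cycle H r" for r
      using girth_le[OF that] p(2) by simp
    have l_le: "?l \<le> length r" if "cycle H r" "odd (length r)" for r
      using odd_girth_le[OF that] c(3) by simp
    \<comment> \<open>The bounds with rounded halves are those of the lemmas, as the length of \<open>c\<close> is odd.\<close>
    have lq: "(?l + 1) div 2 \<le> q \<longleftrightarrow> ?l div 2 < q"
      using c(2) by presburger
    have ln: "?l \<le> n"
      using card_mono[OF finite_verts[OF H] cycle_subset_verts[OF H c(1)]] c(1) n
      by (simp add: cycle_def distinct_card)
    have pure: "pure (MF q G)" if "q < (?l + 1) div 2 \<or> n - ?l div 2 < q"
      unfolding G using that lq n by (intro pure_MF_if_odd_girth[OF H q1 qn l_le]) auto
    have not_pure: "\<not> pure (MF q G)" if "(?l + 1) div 2 \<le> q" "q \<le> n - ?l div 2"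
      unfolding G using that lq n ln by (intro not_pure_MF[OF H c(1,2)]) auto
    have odd_eq: "?m = ?l" if "odd ?m"
      using m_le[OF c(1)] l_le[OF p(1) that] by simp
    have seq: "sequentially_cohen_macaulay TYPE('k) (MF q G)" if "odd ?m" "q = (?m + 1) div 2"
      unfolding G that(2) using qn that(2) by (intro sequentially_cohen_macaulay_MF[OF H that(1) m_le]) auto
    have "(?m + 1) div 2 \<le> n - ?m div 2" if "odd ?m"
      using odd_eq[OF that] ln that by presburger
    then have "\<not> pure (MF q G)" if "odd ?m" "q = (?m + 1) div 2"
      using not_pure odd_eq that by simp
    moreover have "cohen_macaulay TYPE('k) (MF q G)" if "odd ?m" "q < (?m + 1) div 2"
    proof (rule CM[OF p(2)])
      show "q \<le> ?m div 2"
        using that by presburger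
    qed
    ultimately have
      "(even ?m \<longrightarrow>
          (1 \<le> q \<and> q \<le> ?m div 2 \<longrightarrow> cohen_macaulay TYPE('k) (MF q G)) \<and>
          (?m div 2 < q \<and> q < (?l + 1) div 2 \<longrightarrow> pure (MF q G)) \<and>
          ((?l + 1) div 2 \<le> q \<and> q \<le> n - ?l div 2 \<longrightarrow> \<not> pure (MF q G)) \<and>
          (n - ?l div 2 < q \<and> q \<le> matching_number G \<longrightarrow> pure (MF q G))) \<and>
       (odd ?m \<longrightarrow>
          ?m = ?l \<and>
          (1 \<le> q \<and> q < (?m + 1) div 2 \<longrightarrow> cohen_macaulay TYPE('k) (MF q G)) \<and>
          (q = (?m + 1) div 2 \<longrightarrow>
             sequentially_cohen_macaulay TYPE('k) (MF q G) \<and> \<not> pure (MF q G)) \<and>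
          ((?m + 1) div 2 < q \<and> q \<le> n - ?m div 2 \<longrightarrow> \<not> pure (MF q G)) \<and>
          (n - ?m div 2 < q \<and> q \<le> matching_number G \<longrightarrow> pure (MF q G)))"
      using CM[OF p(2)] pure not_pure seq odd_eq by (metis less_imp_le)
    then show ?thesis
      using False p(2) c(3) by blast
  qed
qed

end
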